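(* Let $k\ge1$ be an integer. For each $n\ge 1$ let $(X^{(n)}_m)_{m\ge0}$ be the maximal $k$-choice random walk on $K_n$ (with avoided set the current loop erasure and empty terminating set), and let $Z^{(n)}_m=|\mathrm{LE}(X^{(n)}_0,\dots,X^{(n)}_m)|$ be the number of vertices in its loop erasure at time $m$. Let $(R^{(k)}_t)_{t\ge0}$ be the $k$-Rayleigh process. Then, as $n\to\infty$, $$\left(n^{-\frac{k}{k+1}}Z^{(n)}_{\lfloor t\, n^{\frac{k}{k+1}}\rfloor}\right)_{t\ge0}\overset{(d)}{\longrightarrow}\left(R^{(k)}_t\right)_{t\ge0}$$ with respect to the Skorokhod-$J_1$ topology.
   Context: $K_n$ is the complete graph on $n$ vertices with self-loops, so the neighbours of any vertex are all $n$ vertices. **Loop erasure.** For a finite path $x=(x_0,\dots,x_L)$, $\mathrm{LE}(x)$ is obtained by erasing loops in chronological order: $\lambda_0=0$, and for $i\ge1$, $\lambda_i=1+\max\{t\le L:x_t=x_{\lambda_{i-1}}\}$ as long as $\lambda_i\le L$; $\mathrm{LE}(x)$ is the sequence of the $x_{\lambda_i}$. **Maximal $k$-choice random walk.** $X_0$ is a vertex of $K_n$. Given $X_0,\dots,X_m$, let $\mathrm{Av}_m$ be the set of vertices of $\mathrm{LE}(X_0,\dots,X_m)$ and sample $k$ independent uniform vertices $Y^{(1)},\dots,Y^{(k)}$ of $K_n$. If some $Y^{(l)}\notin\mathrm{Av}_m$, then $X_{m+1}$ is the $Y^{(l)}$ with the smallest such $l$. If all $Y^{(l)}\in\mathrm{Av}_m$,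 then $X_{m+1}$ is the vertex among them whose last visit time by $X$ is the latest (equivalently, which comes last along $\mathrm{LE}(X_0,\dots,X_m)$). **$k$-Rayleigh process.** Let $\Pi_k$ be a Poisson point process on $\mathbb{R}^+\times\mathbb{R}^+$ with intensity $k\,x^{k-1}\,ds\,dx$ at the point $(s,x)$. Then $$R^{(k)}_t=\min\left\{t,\ \inf\{x+(t-s):(s,x)\in\Pi_k,\ s\le t\}\right\},\qquad t\ge0.$$ *)

theory Defs
  imports "HOL-Probability.Probability"
begin

section \<open>Loop erasure and the maximal \<open>k\<close>-choice random walk\<close>

text \<open>
  A path \<open>(x\<^sub>0, \<dots>, x\<^sub>L)\<close> is the list \<open>[x\<^sub>0, \<dots>, x\<^sub>L]\<close>, so \<open>t \<le> L\<close> reads \<open>t < length x\<close>.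
  The value \<open>le_index x i\<close> is the index \<open>\<lambda>\<^sub>i\<close>; it is meaningful only as long as all earlier
  indices are at most \<open>L\<close>, and \<open>loop_erasure\<close> uses no others.
\<close>

primrec le_index :: "'v list \<Rightarrow> nat \<Rightarrow> nat" where
  "le_index x 0 = 0"
| "le_index x (Suc i) = 1 + Max {t. t < length x \<and> x ! t = x ! le_index x i}"

definition loop_erasure :: "'v list \<Rightarrow> 'v list" where
  "loop_erasure x =
     map (\<lambda>i. x ! le_index x i) [0..<(LEAST i. length x \<le> le_index x i)]"

definition last_visit :: "'v list \<Rightarrow> 'v \<Rightarrow> nat" where
  "last_visit x v = Max {t. t < length x \<and> x ! t = v}"

definition max_choice :: "'v list \<Rightarrow> 'v list \<Rightarrow> 'v" where
  "max_choice x ys =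
     (let Av = set (loop_erasure x) in
      if \<exists>l<length ys. ys ! l \<notin> Av
      then ys ! (LEAST l. l < length ys \<and> ys ! l \<notin> Av)
      else (ARG_MAX (last_visit x) v. v \<in> set ys))"

text \<open>
  The vertex set of \<open>K\<^sub>n\<close> is \<open>{..<n}\<close>. The law of the initial vertex is left arbitrary. The last
  clause gives the conditional law of \<open>X\<^sub>m\<^sub>+\<^sub>1\<close> given \<open>(X\<^sub>0, \<dots>, X\<^sub>m) = x\<close>, multiplied out.
\<close>

definition maximal_choice_walk :: "nat \<Rightarrow> nat \<Rightarrow> 'a measure \<Rightarrow> (nat \<Rightarrow> 'a \<Rightarrow> nat) \<Rightarrow> bool" where
  "maximal_choice_walk k n M X \<longleftrightarrow>
     prob_space M \<and>
     (\<forall>m. X m \<in> M \<rightarrow>\<^sub>M count_space {..<n}) \<and>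
     (\<forall>m x v.
        measure M {\<omega> \<in> space M. map (\<lambda>i. X i \<omega>) [0..<Suc m] = x \<and> X (Suc m) \<omega> = v} =
        measure M {\<omega> \<in> space M. map (\<lambda>i. X i \<omega>) [0..<Suc m] = x} *
        pmf (map_pmf (max_choice x) (replicate_pmf k (pmf_of_set {..<n}))) v)"

definition le_length :: "(nat \<Rightarrow> 'a \<Rightarrow> nat) \<Rightarrow> nat \<Rightarrow> 'a \<Rightarrow> nat" where
  "le_length X m \<omega> = length (loop_erasure (map (\<lambda>i. X i \<omega>) [0..<Suc m]))"


section \<open>Poisson point processes and the \<open>k\<close>-Rayleigh process\<close>

text \<open>
  A point process is a random locally finite subset of \<open>space \<mu>\<close>. Multiplicities are not needed,
  since this notion is only used for an atomless intensity \<open>\<mu>\<close>. Counts are taken in \<open>ennreal\<close>, as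
  they may be infinite on unbounded sets.
\<close>

definition point_count :: "('b \<Rightarrow> 'c set) \<Rightarrow> 'c set \<Rightarrow> 'b \<Rightarrow> ennreal" where
  "point_count P B \<omega> = emeasure (count_space UNIV) (P \<omega> \<inter> B)"

definition poisson_point_process ::
    "'b measure \<Rightarrow> 'c::metric_space measure \<Rightarrow> ('b \<Rightarrow> 'c set) \<Rightarrow> bool" where
  "poisson_point_process N \<mu> P \<longleftrightarrow>
     prob_space N \<and>
     (\<forall>\<omega>\<in>space N. P \<omega> \<subseteq> space \<mu> \<and> (\<forall>B. bounded B \<longrightarrow> finite (P \<omega> \<inter> B))) \<and>
     (\<forall>B\<in>sets \<mu>. point_count P B \<in> borel_measurable N) \<and>
     (\<forall>B\<in>sets \<mu>. emeasure \<mu> B < \<infinity> \<longrightarrow>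
        (\<forall>j::nat. measure N {\<omega> \<in> space N. point_count P B \<omega> = of_nat j} =
                    exp (- measure \<mu> B) * measure \<mu> B ^ j / fact j)) \<and>
     (\<forall>(B :: nat \<Rightarrow> 'c set) m. (\<forall>i<m. B i \<in> sets \<mu>) \<and> disjoint_family_on B {..<m} \<longrightarrow>
        prob_space.indep_vars N (\<lambda>_. borel) (\<lambda>i. point_count P (B i)) {..<m})"

definition rayleigh_intensity :: "nat \<Rightarrow> (real \<times> real) measure" where
  "rayleigh_intensity k =
     density (restrict_space lborel ({0..} \<times> {0..})) (\<lambda>(s, x). ennreal (real k * x ^ (k - 1)))"

text \<open>The infimum is taken in \<open>ereal\<close>, so that it is \<open>\<infinity>\<close> when there is no point with \<open>s \<le> t\<close>.\<close>

definition rayleigh :: "(real \<times> real) set \<Rightarrow> real \<Rightarrow> real" where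
  "rayleigh S t =
     real_of_ereal (min (ereal t) (INF (s, x) \<in> {(s, x). (s, x) \<in> S \<and> s \<le> t}. ereal (x + (t - s))))"


section \<open>The Skorokhod \<open>J\<^sub>1\<close> topology on \<open>D[0, \<infinity>)\<close>\<close>

text \<open>
  Paths are functions on \<open>[0, \<infinity>)\<close>, represented by their \<^const>\<open>extensional\<close> extensions.
\<close>

definition cadlag_paths :: "(real \<Rightarrow> real) set" where
  "cadlag_paths = {f \<in> extensional {0..}.
     (\<forall>t\<ge>0. (f \<longlongrightarrow> f t) (at_right t)) \<and> (\<forall>t>0. \<exists>l. (f \<longlongrightarrow> l) (at_left t))}"

definition time_changes :: "(real \<Rightarrow> real) set" where
  "time_changes = {\<tau>. continuous_on {0..} \<tau> \<and> strict_mono_on {0..} \<tau> \<and> \<tau> ` {0..} = {0..}}"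

text \<open>
  On \<open>D[0, \<infinity>)\<close> the \<open>J\<^sub>1\<close> topology is the metrizable topology whose convergent sequences are those
  for which there are time changes converging to the identity uniformly on \<open>[0, \<infinity>)\<close> and aligning
  the paths uniformly on every \<open>[0, T]\<close> (Billingsley, Convergence of Probability Measures, 2nd ed.,
  Theorem 16.1; Jacod and Shiryaev, Limit Theorems for Stochastic Processes, Theorem VI.1.14).
  It is given here by the corresponding neighbourhood base. Lemma \<open>limitin_skorokhod_J1\<close> shows that
  the convergent sequences are the right ones; as \<open>J1_nhd f m (1 / m)\<close>, \<open>m \<ge> 1\<close>, is a countable
  base at \<open>f\<close>, this determines the topology.
\<close>

definition J1_nhd :: "(real \<Rightarrow> real) \<Rightarrow> real \<Rightarrow> real \<Rightarrow> (real \<Rightarrow> real) set" where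
  "J1_nhd f T e = {g \<in> cadlag_paths. \<exists>\<tau>\<in>time_changes.
     (\<forall>t\<ge>0. \<bar>\<tau> t - t\<bar> < e) \<and> (\<forall>t\<in>{0..T}. \<bar>g (\<tau> t) - f t\<bar> < e)}"

definition skorokhod_J1 :: "(real \<Rightarrow> real) topology" where
  "skorokhod_J1 =
     topology (\<lambda>U. U \<subseteq> cadlag_paths \<and> (\<forall>f\<in>U. \<exists>T. \<exists>e>0. J1_nhd f T e \<subseteq> U))"

lemma J1_nhd_mono: "T' \<le> T \<Longrightarrow> e \<le> e' \<Longrightarrow> J1_nhd f T e \<subseteq> J1_nhd f T' e'"
  unfolding J1_nhd_def by (force intro: less_le_trans)

lemma id_time_change: "(\<lambda>t. t) \<in> time_changes"
  by (auto simp: time_changes_def strict_mono_on_def)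

lemma J1_nhd_self: "f \<in> cadlag_paths \<Longrightarrow> 0 < e \<Longrightarrow> f \<in> J1_nhd f T e"
  unfolding J1_nhd_def using id_time_change by (auto intro!: bexI[of _ "\<lambda>t. t"])

lemma time_change_nonneg: "\<tau> \<in> time_changes \<Longrightarrow> 0 \<le> t \<Longrightarrow> 0 \<le> \<tau> t"
  unfolding time_changes_def by fastforce

lemma time_change_comp:
  assumes "\<tau> \<in> time_changes" "\<sigma> \<in> time_changes"
  shows "(\<lambda>t. \<sigma> (\<tau> t)) \<in> time_changes"
proof -
  have img: "\<tau> ` {0..} = {0..}" "\<sigma> ` {0..} = {0..}"
    using assms by (auto simp: time_changes_def)
  have "continuous_on {0..} (\<lambda>t. \<sigma> (\<tau> t))"
    using assms img by (auto simp: time_changes_def intro!: continuous_on_compose2[of "{0..}" \<sigma>])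
  moreover have "strict_mono_on {0..} (\<lambda>t. \<sigma> (\<tau> t))"
    using assms time_change_nonneg[OF assms(1)] by (simp add: time_changes_def strict_mono_on_def)
  moreover have "(\<lambda>t. \<sigma> (\<tau> t)) ` {0..} = {0..}"
    using img by (metis image_image)
  ultimately show ?thesis by (simp add: time_changes_def)
qed

lemma J1_nhd_triangle:
  assumes e: "0 < e" and h: "h \<in> J1_nhd g (T + e) (e / 2)" and p: "p \<in> J1_nhd h (T + e) (e / 2)"
  shows "p \<in> J1_nhd g T e"
proof -
  obtain \<tau> where l: "\<tau> \<in> time_changes" "\<And>t. t \<ge> 0 \<Longrightarrow> \<bar>\<tau> t - t\<bar> < e / 2"
      "\<And>t. t \<in> {0..T + e} \<Longrightarrow> \<bar>h (\<tau> t) - g t\<bar> < e / 2"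
    using h unfolding J1_nhd_def by blast
  obtain \<sigma> where m: "\<sigma> \<in> time_changes" "\<And>t. t \<ge> 0 \<Longrightarrow> \<bar>\<sigma> t - t\<bar> < e / 2"
      "\<And>t. t \<in> {0..T + e} \<Longrightarrow> \<bar>p (\<sigma> t) - h t\<bar> < e / 2" and pc: "p \<in> cadlag_paths"
    using p unfolding J1_nhd_def by blast
  have 1: "\<bar>\<sigma> (\<tau> t) - t\<bar> < e" if "t \<ge> 0" for t
    using l(2)[OF that] m(2)[OF time_change_nonneg[OF l(1) that]] by linarith
  have 2: "\<bar>p (\<sigma> (\<tau> t)) - g t\<bar> < e" if t: "t \<in> {0..T}" for t
  proof -
    have "\<tau> t \<in> {0..T + e}"
      using t l(2)[of t] time_change_nonneg[OF l(1), of t] e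
      unfolding atLeastAtMost_iff by linarith
    moreover have "t \<in> {0..T + e}" using t e by auto
    ultimately show ?thesis using l(3)[of t] m(3)[of "\<tau> t"] by linarith
  qed
  show ?thesis
    unfolding J1_nhd_def using pc time_change_comp[OF l(1) m(1)] 1 2
    by (auto intro!: bexI[of _ "\<lambda>t. \<sigma> (\<tau> t)"])
qed

lemma openin_skorokhod_J1:
  "openin skorokhod_J1 U \<longleftrightarrow>
     U \<subseteq> cadlag_paths \<and> (\<forall>f\<in>U. \<exists>T. \<exists>e>0. J1_nhd f T e \<subseteq> U)"
proof -
  have "istopology (\<lambda>U. U \<subseteq> cadlag_paths \<and> (\<forall>f\<in>U. \<exists>T. \<exists>e>0. J1_nhd f T e \<subseteq> U))"
    unfolding istopology_def
  proof (rule conjI; intro allI impI conjI ballI)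
    fix S S' f
    assume S: "S \<subseteq> cadlag_paths \<and> (\<forall>f\<in>S. \<exists>T. \<exists>e>0. J1_nhd f T e \<subseteq> S)"
      and S': "S' \<subseteq> cadlag_paths \<and> (\<forall>f\<in>S'. \<exists>T. \<exists>e>0. J1_nhd f T e \<subseteq> S')" and f: "f \<in> S \<inter> S'"
    obtain T e where 1: "e > 0" "J1_nhd f T e \<subseteq> S" using S f by blast
    obtain T' e' where 2: "e' > 0" "J1_nhd f T' e' \<subseteq> S'" using S' f by blast
    have "J1_nhd f (max T T') (min e e') \<subseteq> S \<inter> S'"
      using 1 2 J1_nhd_mono[of T "max T T'" "min e e'" e f] J1_nhd_mono[of T' "max T T'" "min e e'" e' f]
      by auto
    moreover have "min e e' > 0" using 1 2 by auto
    ultimately show "\<exists>T. \<exists>e>0. J1_nhd f T e \<subseteq> S \<inter> S'" by blast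
  next
    fix K
    assume K: "\<forall>S\<in>K. S \<subseteq> cadlag_paths \<and> (\<forall>f\<in>S. \<exists>T. \<exists>e>0. J1_nhd f T e \<subseteq> S)"
    show "\<Union>K \<subseteq> cadlag_paths" using K by blast
    fix f assume "f \<in> \<Union>K"
    then obtain S where S: "S \<in> K" "f \<in> S" by blast
    then obtain T e where "e > 0" "J1_nhd f T e \<subseteq> S" using K by blast
    thus "\<exists>T. \<exists>e>0. J1_nhd f T e \<subseteq> \<Union>K" using S(1) by blast
  qed blast
  thus ?thesis by (simp add: skorokhod_J1_def topology_inverse')
qed

lemma topspace_skorokhod_J1: "topspace skorokhod_J1 = cadlag_paths"
proof -
  have "openin skorokhod_J1 cadlag_paths"
    unfolding openin_skorokhod_J1 by (auto simp: J1_nhd_def intro: exI[of _ "1::real"])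
  thus ?thesis
    by (meson openin_skorokhod_J1 openin_subset openin_topspace subset_antisym)
qed

lemma J1_nhd_contains_open:
  assumes f: "f \<in> cadlag_paths" and e: "e > 0"
  shows "\<exists>U. openin skorokhod_J1 U \<and> f \<in> U \<and> U \<subseteq> J1_nhd f T e"
proof -
  define U where "U = {g \<in> cadlag_paths. \<exists>T'. \<exists>e'>0. J1_nhd g T' e' \<subseteq> J1_nhd f T e}"
  have "\<exists>T. \<exists>e>0. J1_nhd g T e \<subseteq> U" if g: "g \<in> U" for g
  proof -
    obtain T' e' where 1: "e' > 0" "J1_nhd g T' e' \<subseteq> J1_nhd f T e"
      using g unfolding U_def by blast
    have "J1_nhd g (T' + e') (e' / 2) \<subseteq> U"
    proof
      fix h assume h: "h \<in> J1_nhd g (T' + e') (e' / 2)"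
      hence "J1_nhd h (T' + e') (e' / 2) \<subseteq> J1_nhd f T e"
        using J1_nhd_triangle[OF 1(1) h] 1(2) by blast
      moreover have "h \<in> cadlag_paths" using h by (simp add: J1_nhd_def)
      moreover have "e' / 2 > 0" using 1 by simp
      ultimately show "h \<in> U" unfolding U_def by blast
    qed
    thus ?thesis using 1(1) by (meson half_gt_zero)
  qed
  hence "openin skorokhod_J1 U" unfolding openin_skorokhod_J1 by (auto simp: U_def)
  moreover have "f \<in> U" using f e by (auto simp: U_def)
  moreover have "U \<subseteq> J1_nhd f T e" using J1_nhd_self by (auto simp: U_def)
  ultimately show ?thesis by blast
qed

lemma limitin_skorokhod_J1:
  "limitin skorokhod_J1 F f sequentially \<longleftrightarrow>
     f \<in> cadlag_paths \<and> (\<forall>\<^sub>F n in sequentially. F n \<in> cadlag_paths) \<and>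
     (\<exists>\<Lambda>. (\<forall>n. \<Lambda> n \<in> time_changes) \<and>
        (\<forall>e>0. \<forall>\<^sub>F n in sequentially. \<forall>t\<ge>0. \<bar>\<Lambda> n t - t\<bar> < e) \<and>
        (\<forall>T. \<forall>e>0. \<forall>\<^sub>F n in sequentially. \<forall>t\<in>{0..T}. \<bar>F n (\<Lambda> n t) - f t\<bar> < e))"
    (is "?L \<longleftrightarrow> ?R")
proof
  assume ?R
  then obtain \<Lambda> where f: "f \<in> cadlag_paths" and F: "\<forall>\<^sub>F n in sequentially. F n \<in> cadlag_paths"
    and L: "\<And>n. \<Lambda> n \<in> time_changes"
      "\<And>e. e > 0 \<Longrightarrow> \<forall>\<^sub>F n in sequentially. \<forall>t\<ge>0. \<bar>\<Lambda> n t - t\<bar> < e"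
      "\<And>T e. e > 0 \<Longrightarrow> \<forall>\<^sub>F n in sequentially. \<forall>t\<in>{0..T}. \<bar>F n (\<Lambda> n t) - f t\<bar> < e"
    by blast
  have "\<forall>\<^sub>F n in sequentially. F n \<in> U" if U: "openin skorokhod_J1 U" "f \<in> U" for U
  proof -
    obtain T e where e: "e > 0" "J1_nhd f T e \<subseteq> U" using U openin_skorokhod_J1 by blast
    show ?thesis
      using F L(2)[OF e(1)] L(3)[OF e(1), of T]
    proof eventually_elim
      case (elim n)
      hence "F n \<in> J1_nhd f T e" using L(1)[of n] unfolding J1_nhd_def by blast
      thus ?case using e(2) by blast
    qed
  qed
  thus ?L by (simp add: limitin_def topspace_skorokhod_J1 f)
next
  assume lim: ?L
  hence f: "f \<in> cadlag_paths" by (simp add: limitin_def topspace_skorokhod_J1)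
  have ev: "\<forall>\<^sub>F n in sequentially. F n \<in> J1_nhd f T e" if e: "e > 0" for T e
  proof -
    obtain U where "openin skorokhod_J1 U" "f \<in> U" "U \<subseteq> J1_nhd f T e"
      using J1_nhd_contains_open[OF f e] by blast
    thus ?thesis using lim by (auto simp: limitin_def elim!: eventually_mono)
  qed
  define V where "V m = J1_nhd f (real m) (1 / real (Suc m))" for m
  define S where "S n = {m. m \<le> n \<and> F n \<in> V m}" for n
  have fin: "finite (S n)" for n by (auto simp: S_def)
  define Q where "Q n \<tau> \<longleftrightarrow>
      (\<forall>t\<ge>0. \<bar>\<tau> t - t\<bar> < 1 / real (Suc (Max (S n)))) \<and>
      (\<forall>t\<in>{0..real (Max (S n))}. \<bar>F n (\<tau> t) - f t\<bar> < 1 / real (Suc (Max (S n))))" for n \<tau>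
  have wit: "\<forall>n. \<exists>\<tau>. \<tau> \<in> time_changes \<and> (S n \<noteq> {} \<longrightarrow> Q n \<tau>)"
  proof
    fix n
    show "\<exists>\<tau>. \<tau> \<in> time_changes \<and> (S n \<noteq> {} \<longrightarrow> Q n \<tau>)"
    proof (cases "S n = {}")
      case True thus ?thesis using id_time_change by blast
    next
      case False
      hence "F n \<in> V (Max (S n))" using Max_in[OF fin] unfolding S_def by blast
      thus ?thesis unfolding V_def J1_nhd_def Q_def by blast
    qed
  qed
  obtain \<Lambda> where "\<forall>n. \<Lambda> n \<in> time_changes \<and> (S n \<noteq> {} \<longrightarrow> Q n (\<Lambda> n))"
    using choice[OF wit] by blast
  hence L: "\<And>n. \<Lambda> n \<in> time_changes" "\<And>n. S n \<noteq> {} \<Longrightarrow> Q n (\<Lambda> n)"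
    by auto
  have key: "\<forall>\<^sub>F n in sequentially. (\<forall>t\<ge>0. \<bar>\<Lambda> n t - t\<bar> < e) \<and> (\<forall>t\<in>{0..T}. \<bar>F n (\<Lambda> n t) - f t\<bar> < e)"
    if e: "e > 0" for T e
  proof -
    obtain m1 where m1: "T \<le> real m1" using real_arch_simple by blast
    obtain m2 where m2: "1 / real (Suc m2) < e" using e nat_approx_posE by blast
    define m where "m = max m1 m2"
    have m: "T \<le> real m" using m1 by (auto simp: m_def)
    have "1 / real (Suc m) \<le> 1 / real (Suc m2)" by (auto simp: m_def frac_le)
    hence me: "1 / real (Suc m) < e" using m2 by linarith
    have "\<forall>\<^sub>F n in sequentially. F n \<in> V m" unfolding V_def by (rule ev) simp
    thus ?thesis using eventually_ge_at_top[of m]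
    proof eventually_elim
      case (elim n)
      hence mS: "m \<in> S n" by (simp add: S_def)
      hence le: "m \<le> Max (S n)" using fin by simp
      have "1 / real (Suc (Max (S n))) \<le> 1 / real (Suc m)" using le by (auto simp: frac_le)
      hence 1: "1 / real (Suc (Max (S n))) < e" using me by linarith
      have 2: "T \<le> real (Max (S n))" using m le by linarith
      have "S n \<noteq> {}" using mS by blast
      note w = L(2)[OF this, unfolded Q_def]
      have "\<bar>\<Lambda> n t - t\<bar> < e" if "t \<ge> 0" for t
        using w that 1 less_trans by blast
      moreover have "\<bar>F n (\<Lambda> n t) - f t\<bar> < e" if "t \<in> {0..T}" for t
      proof -
        have "t \<in> {0..real (Max (S n))}" using that 2 by auto
        thus ?thesis using w 1 less_trans by blast
      qed
      ultimately show ?case by blast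
    qed
  qed
  have "\<forall>\<^sub>F n in sequentially. F n \<in> cadlag_paths"
    using ev[of 1 0] by (auto simp: J1_nhd_def elim!: eventually_mono)
  moreover have "\<forall>e>0. \<forall>\<^sub>F n in sequentially. \<forall>t\<ge>0. \<bar>\<Lambda> n t - t\<bar> < e"
    using key by (auto simp: eventually_conj_iff)
  moreover have "\<forall>T. \<forall>e>0. \<forall>\<^sub>F n in sequentially. \<forall>t\<in>{0..T}. \<bar>F n (\<Lambda> n t) - f t\<bar> < e"
    using key by (auto simp: eventually_conj_iff)
  ultimately show ?R using f L(1) by blast
qed


section \<open>Convergence in distribution\<close>

definition borel_of :: "'c topology \<Rightarrow> 'c measure" where
  "borel_of T = sigma (topspace T) {U. openin T U}"

definition converges_in_distribution ::
    "'c topology \<Rightarrow> (nat \<Rightarrow> 'a measure) \<Rightarrow> (nat \<Rightarrow> 'a \<Rightarrow> 'c) \<Rightarrow> 'b measure \<Rightarrow> ('b \<Rightarrow> 'c) \<Rightarrow> bool" where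
  "converges_in_distribution T M Z N R \<longleftrightarrow>
     (\<forall>\<^sub>F n in sequentially. Z n \<in> M n \<rightarrow>\<^sub>M borel_of T) \<and> R \<in> N \<rightarrow>\<^sub>M borel_of T \<and>
     (\<forall>\<phi>. continuous_map T euclideanreal \<phi> \<and> bounded (\<phi> ` topspace T) \<longrightarrow>
        (\<lambda>n. \<integral>\<omega>. \<phi> (Z n \<omega>) \<partial>M n) \<longlonglongrightarrow> (\<integral>\<omega>. \<phi> (R \<omega>) \<partial>N))"

end

theory Submission
  imports Defs
begin

text \<open>
  The loop erasure of the walk is an ordered list of distinct vertices. Number its
  vertices along the list and the remaining ones arbitrarily. The next loop erasure has at most
  \<open>j\<close> vertices, for \<open>j\<close> at most the current length \<open>z\<close>, iff all \<open>k\<close> samples have rank at most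
  \<open>j\<close>: a sample outside the list makes it grow, and otherwise the walk jumps back to the sample
  that comes last along the list and cuts off everything behind it. So the length passes from \<open>z\<close>
  to \<open>min (z + 1) U\<close>, where \<open>U\<close> is the maximum of \<open>k\<close> independent uniform ranks and is
  independent of the past (\<open>le_length_Suc_law\<close>). Hence the length at time \<open>m\<close> has the law of the
  minimum of \<open>m + 1\<close> and of all \<open>U\<^sub>i + (m - 1 - i)\<close> with \<open>i < m\<close>, which is the discrete form of the
  \<open>k\<close>-Rayleigh process, the points \<open>(i, U\<^sub>i)\<close> playing the role of the Poisson points.

  Let \<open>a = n powr (k / (k + 1))\<close>, so that \<open>a ^ (k + 1) = n ^ k\<close>. Instead of
  proving convergence of laws, ranks are read off the given Poisson process: \<open>U\<^sub>i\<close> is a monotone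
  function of the height of the lowest point with abscissa in \<open>[i / a, (i + 1) / a)\<close>. That height
  exceeds \<open>h\<close> with probability \<open>exp (- h ^ k / a)\<close>, so the quantile transformation gives
  \<open>U\<^sub>i\<close> exactly the law of the maximum of \<open>k\<close> uniform ranks, and the \<open>U\<^sub>i\<close> are independent because
  the strips are disjoint (\<open>strip_rank_law\<close>, \<open>strip_rank_indep\<close>). For large \<open>n\<close> the transformation
  is close to multiplication by \<open>a\<close> on bounded heights.

  With this coupling the rescaled chain converges in \<open>J\<^sub>1\<close> to the Rayleigh path at
  every sample point (\<open>scaled_min_chain_tendsto_rayleigh\<close>): up to time \<open>T\<close> only finitely many
  Poisson points matter, and a time change that moves each of their abscissae to the right end of
  its strip aligns the two paths. Convergence in distribution follows by dominated convergence
  (\<open>integral_J1_limit\<close>), as the walk and the coupled chain have the same law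
  (\<open>le_length_law_eq_min_chain\<close>). Measurability of the limit comes for free, since a pointwise
  \<open>J\<^sub>1\<close> limit of measurable maps is measurable (\<open>measurable_J1_limit\<close>).
\<close>

section \<open>Limits and measurability in the Skorokhod topology\<close>

lemma limitin_skorokhod_J1I:
  assumes f: "f \<in> cadlag_paths"
    and F: "\<And>T e. e > 0 \<Longrightarrow> \<forall>\<^sub>F n in sequentially. F n \<in> J1_nhd f T e"
  shows "limitin skorokhod_J1 F f sequentially"
proof -
  have "\<forall>\<^sub>F n in sequentially. F n \<in> U" if U: "openin skorokhod_J1 U" "f \<in> U" for U
  proof -
    obtain T e where "e > 0" "J1_nhd f T e \<subseteq> U" using U openin_skorokhod_J1 by blast
    thus ?thesis using F[of e T] by (auto elim!: eventually_mono)
  qed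
  thus ?thesis by (simp add: limitin_def topspace_skorokhod_J1 f)
qed

lemma limitin_skorokhod_J1D:
  assumes "limitin skorokhod_J1 F f sequentially" "e > 0"
  shows "\<forall>\<^sub>F n in sequentially. F n \<in> J1_nhd f T e"
proof -
  have "f \<in> cadlag_paths" using assms by (simp add: limitin_def topspace_skorokhod_J1)
  then obtain U where "openin skorokhod_J1 U" "f \<in> U" "U \<subseteq> J1_nhd f T e"
    using J1_nhd_contains_open assms(2) by blast
  thus ?thesis using assms(1) by (auto simp: limitin_def elim!: eventually_mono)
qed

lemma time_change_inverse:
  assumes "\<tau> \<in> time_changes"
  obtains \<sigma> where "\<sigma> \<in> time_changes" "\<And>t. t \<ge> 0 \<Longrightarrow> \<tau> (\<sigma> t) = t"
proof -
  have \<tau>: "continuous_on {0..} \<tau>" "strict_mono_on {0..} \<tau>" "\<tau> ` {0..} = {0..}"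
    using assms by (auto simp: time_changes_def)
  obtain \<sigma> where h: "homeomorphism {0..} {0..} \<tau> \<sigma>"
    using homeomorphism_into_1d[of "{0..}" \<tau> "{0..}"] \<tau> strict_mono_on_imp_inj_on
    by (metis convex_imp_path_connected convex_real_interval(1))
  have inv: "\<tau> (\<sigma> t) = t" "\<sigma> t \<ge> 0" if "t \<ge> 0" for t
    using h that by (auto simp: homeomorphism_def)
  have "strict_mono_on {0..} \<sigma>"
  proof (rule strict_mono_onI)
    fix r s :: real assume rs: "r \<in> {0..}" "s \<in> {0..}" "r < s"
    show "\<sigma> r < \<sigma> s"
    proof (rule ccontr)
      assume "\<not> \<sigma> r < \<sigma> s"
      hence "\<tau> (\<sigma> s) \<le> \<tau> (\<sigma> r)"
        using inv(2) rs strict_mono_on_leD[OF \<tau>(2), of "\<sigma> s" "\<sigma> r"] by simp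
      thus False using inv(1) rs by simp
    qed
  qed
  hence "\<sigma> \<in> time_changes" using h by (auto simp: time_changes_def homeomorphism_def)
  thus thesis using that inv by blast
qed

text \<open>
  Inverting the time change exchanges the two paths. The horizon shrinks by \<open>e\<close>, because the inverse
  may move a time in \<open>[0, T]\<close> up to \<open>T + e\<close>.
\<close>

lemma J1_nhd_sym:
  assumes g: "g \<in> J1_nhd f (T + e) e" and f: "f \<in> cadlag_paths"
  shows "f \<in> J1_nhd g T e"
proof -
  obtain \<tau> where \<tau>: "\<tau> \<in> time_changes" "\<And>t. t \<ge> 0 \<Longrightarrow> \<bar>\<tau> t - t\<bar> < e"
      "\<And>t. t \<in> {0..T + e} \<Longrightarrow> \<bar>g (\<tau> t) - f t\<bar> < e"
    using g unfolding J1_nhd_def by blast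
  obtain \<sigma> where \<sigma>: "\<sigma> \<in> time_changes" "\<And>t. t \<ge> 0 \<Longrightarrow> \<tau> (\<sigma> t) = t"
    using time_change_inverse[OF \<tau>(1)] by blast
  have 1: "\<bar>\<sigma> t - t\<bar> < e" if "t \<ge> 0" for t
    using \<tau>(2)[OF time_change_nonneg[OF \<sigma>(1) that]] \<sigma>(2)[OF that] by auto
  have 2: "\<bar>f (\<sigma> t) - g t\<bar> < e" if t: "t \<in> {0..T}" for t
  proof -
    have "t \<ge> 0" using t by simp
    hence "\<sigma> t \<in> {0..T + e}"
      using 1[of t] t time_change_nonneg[OF \<sigma>(1), of t] unfolding atLeastAtMost_iff by linarith
    thus ?thesis using \<tau>(3)[of "\<sigma> t"] \<sigma>(2)[OF \<open>t \<ge> 0\<close>] by auto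
  qed
  show ?thesis unfolding J1_nhd_def using f \<sigma>(1) 1 2 by blast
qed

lemma space_borel_of [simp]: "space (borel_of T) = topspace T"
  unfolding borel_of_def by (rule space_measure_of) (auto dest: openin_subset)

lemma openin_in_borel_of: "openin T U \<Longrightarrow> U \<in> sets (borel_of T)"
  unfolding borel_of_def by (subst sets_measure_of) (auto dest: openin_subset)

lemma measurable_borel_ofI:
  assumes "\<And>\<omega>. \<omega> \<in> space M \<Longrightarrow> f \<omega> \<in> topspace T"
    and "\<And>U. openin T U \<Longrightarrow> f -` U \<inter> space M \<in> sets M"
  shows "f \<in> M \<rightarrow>\<^sub>M borel_of T"
  unfolding borel_of_def using assms by (intro measurable_measure_of) (auto dest: openin_subset)

lemma continuous_map_measurable_borel_of:
  assumes "continuous_map T euclideanreal \<phi>"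
  shows "\<phi> \<in> borel_measurable (borel_of T)"
proof (rule borel_measurableI)
  fix S :: "real set" assume "open S"
  hence "openin T {x \<in> topspace T. \<phi> x \<in> S}"
    using assms by (simp add: continuous_map_def)
  moreover have "\<phi> -` S \<inter> space (borel_of T) = {x \<in> topspace T. \<phi> x \<in> S}" by auto
  ultimately show "\<phi> -` S \<inter> space (borel_of T) \<in> sets (borel_of T)"
    by (simp add: openin_in_borel_of)
qed

text \<open>
  An open set \<open>U\<close> is exhausted by the open sets \<open>B m\<close> of paths that keep a margin \<open>1 / (m + 1)\<close> from
  the complement of \<open>U\<close> on \<open>[0, m]\<close>. The limit lies in \<open>U\<close> iff for some \<open>m\<close> the sequence is eventually
  in \<open>B m\<close>: a limit in \<open>U\<close> lies in some \<open>B m\<close>, and conversely the margin of the sequence, by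
  \<open>J1_nhd_sym\<close>, is enough to reach the limit. The right-hand side is a countable combination of
  measurable events.
\<close>

lemma measurable_J1_limit:
  assumes Z: "\<And>n. Z n \<in> M \<rightarrow>\<^sub>M borel_of skorokhod_J1"
    and lim: "\<And>\<omega>. \<omega> \<in> space M \<Longrightarrow> limitin skorokhod_J1 (\<lambda>n. Z n \<omega>) (R \<omega>) sequentially"
  shows "R \<in> M \<rightarrow>\<^sub>M borel_of skorokhod_J1"
proof (rule measurable_borel_ofI)
  have Rc: "R \<omega> \<in> cadlag_paths" if "\<omega> \<in> space M" for \<omega>
    using lim[OF that] by (simp add: limitin_def topspace_skorokhod_J1)
  thus "R \<omega> \<in> topspace skorokhod_J1" if "\<omega> \<in> space M" for \<omega>
    using that by (simp add: topspace_skorokhod_J1)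
  fix U assume U: "openin skorokhod_J1 U"
  define A where "A m = {f. J1_nhd f (real m) (1 / real (Suc m)) \<subseteq> U}" for m
  define B where "B m = skorokhod_J1 interior_of A m" for m
  have B: "openin skorokhod_J1 (B m)" "B m \<subseteq> A m" for m
    by (auto simp: B_def interior_of_subset)
  have "R \<omega> \<in> U \<longleftrightarrow> (\<exists>m n0. \<forall>n\<ge>n0. Z n \<omega> \<in> B m)" if \<omega>: "\<omega> \<in> space M" for \<omega>
  proof
    assume "R \<omega> \<in> U"
    then obtain T e where e: "e > 0" "J1_nhd (R \<omega>) T e \<subseteq> U"
      using U openin_skorokhod_J1 by blast
    obtain m1 where m1: "T + e \<le> real m1" using real_arch_simple by blast
    obtain m2 where m2: "1 / real (Suc m2) < e / 2" using e nat_approx_posE half_gt_zero by blast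
    define m where "m = max m1 m2"
    have "1 / real (Suc m) \<le> 1 / real (Suc m2)" by (auto simp: m_def frac_le)
    hence m: "T + e \<le> real m" "1 / real (Suc m) \<le> e / 2" using m1 m2 by (auto simp: m_def)
    have "J1_nhd (R \<omega>) (T + e) (e / 2) \<subseteq> A m"
      using J1_nhd_triangle[OF e(1)] J1_nhd_mono[OF m] e(2) unfolding A_def by blast
    moreover obtain V where "openin skorokhod_J1 V" "R \<omega> \<in> V" "V \<subseteq> J1_nhd (R \<omega>) (T + e) (e / 2)"
      using J1_nhd_contains_open[OF Rc[OF \<omega>]] e(1) half_gt_zero by metis
    ultimately have "R \<omega> \<in> B m" unfolding B_def interior_of_def by blast
    thus "\<exists>m n0. \<forall>n\<ge>n0. Z n \<omega> \<in> B m"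
      using lim[OF \<omega>] B(1) unfolding limitin_def eventually_sequentially by blast
  next
    assume "\<exists>m n0. \<forall>n\<ge>n0. Z n \<omega> \<in> B m"
    then obtain m where m: "\<forall>\<^sub>F n in sequentially. Z n \<omega> \<in> B m"
      unfolding eventually_sequentially by blast
    have "\<forall>\<^sub>F n in sequentially. Z n \<omega> \<in> J1_nhd (R \<omega>) (real m + 1 / real (Suc m)) (1 / real (Suc m))"
      by (rule limitin_skorokhod_J1D[OF lim[OF \<omega>]]) simp
    from eventually_conj[OF m this] obtain n where
      "Z n \<omega> \<in> B m" "Z n \<omega> \<in> J1_nhd (R \<omega>) (real m + 1 / real (Suc m)) (1 / real (Suc m))"
      by (auto simp: eventually_sequentially)
    thus "R \<omega> \<in> U" using J1_nhd_sym[OF _ Rc[OF \<omega>]] B(2) unfolding A_def by blast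
  qed
  hence eq: "R -` U \<inter> space M = (\<Union>m. \<Union>n0. (\<Inter>n\<in>{n0..}. Z n -` B m \<inter> space M))"
    by fastforce
  have "Z n -` B m \<inter> space M \<in> sets M" for n m
    using measurable_sets[OF Z openin_in_borel_of[OF B(1)]] by simp
  thus "R -` U \<inter> space M \<in> sets M"
    unfolding eq by (intro sets.countable_UN sets.countable_INT'' sets.countable_UN'' sets.countable_INT') auto
qed

section \<open>Rescaled step paths\<close>

definition scaled_path :: "real \<Rightarrow> (nat \<Rightarrow> nat) \<Rightarrow> real \<Rightarrow> real" where
  "scaled_path a z = (\<lambda>t\<in>{0..}. inverse a * real (z (nat \<lfloor>t * a\<rfloor>)))"

lemma scaled_path_cadlag:
  assumes a: "a \<ge> 0"
  shows "scaled_path a z \<in> cadlag_paths"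
proof (cases "a = 0")
  \<comment> \<open>For \<open>a = 0\<close> the path is constantly zero, as \<open>inverse 0 = 0\<close>.\<close>
  case True
  have "((\<lambda>t\<in>{0..}. 0 :: real) \<longlongrightarrow> 0) (at_right t)" if "t \<ge> 0" for t :: real
    using that by (intro tendsto_eventually) (auto simp: eventually_at_right_field intro!: exI[of _ "t + 1"])
  moreover have "((\<lambda>t\<in>{0..}. 0 :: real) \<longlongrightarrow> 0) (at_left t)" if "t > 0" for t :: real
    using that by (intro tendsto_eventually) (auto simp: eventually_at_left_field intro!: exI[of _ 0])
  ultimately show ?thesis using True by (auto simp: scaled_path_def cadlag_paths_def)
next
  case False
  hence a: "a > 0" using a by simp
  have r: "(scaled_path a z \<longlongrightarrow> scaled_path a z t) (at_right t)" if t: "t \<ge> 0" for t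
  proof (rule tendsto_eventually)
    have "t < (of_int \<lfloor>t * a\<rfloor> + 1) / a" using a by (simp add: pos_less_divide_eq)
    moreover have "\<lfloor>u * a\<rfloor> = \<lfloor>t * a\<rfloor>" if u: "u > t" "u < (of_int \<lfloor>t * a\<rfloor> + 1) / a" for u
    proof -
      have "t * a \<le> u * a" using u a by simp
      moreover have "u * a < of_int \<lfloor>t * a\<rfloor> + 1" using u a by (simp add: pos_less_divide_eq)
      ultimately show ?thesis by linarith
    qed
    ultimately show "\<forall>\<^sub>F u in at_right t. scaled_path a z u = scaled_path a z t"
      unfolding eventually_at_right_field using t
      by (intro exI[of _ "(of_int \<lfloor>t * a\<rfloor> + 1) / a"]) (auto simp: scaled_path_def)
  qed
  have l: "\<exists>l. (scaled_path a z \<longlongrightarrow> l) (at_left t)" if t: "t > 0" for t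
  proof (rule exI, rule tendsto_eventually)
    let ?c = "\<lceil>t * a\<rceil> - 1"
    have c: "of_int ?c < t * a" by linarith
    have c0: "?c \<ge> 0" using t a by simp
    have "of_int ?c / a < t" using c a by (simp add: pos_divide_less_eq)
    moreover have "\<lfloor>u * a\<rfloor> = ?c" if u: "u < t" "u > of_int ?c / a" for u
    proof -
      have "u * a < t * a" using u a by simp
      moreover have "u * a > of_int ?c" using u a by (simp add: pos_divide_less_eq)
      ultimately show ?thesis by linarith
    qed
    moreover have "u \<ge> 0" if "u > of_int ?c / a" for u
    proof -
      have "of_int ?c / a \<ge> 0" using c0 a by (intro divide_nonneg_pos) auto
      thus ?thesis using that by linarith
    qed
    ultimately show "\<forall>\<^sub>F u in at_left t. scaled_path a z u = inverse a * real (z (nat ?c))"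
      unfolding eventually_at_left_field
      by (intro exI[of _ "of_int ?c / a"]) (auto simp: scaled_path_def)
  qed
  show ?thesis using r l by (auto simp: cadlag_paths_def) (auto simp: scaled_path_def)
qed

text \<open>
  Freezing the sequence at time \<open>l\<close> leaves a path that depends on a finite prefix only, and prefixes
  range over a countable set. Questions about the measurability and the law of the whole path thus
  reduce to prefixes, without a measure on the space of sequences.
\<close>

lemma scaled_path_freeze:
  assumes a: "a \<ge> 0"
  shows "limitin skorokhod_J1 (\<lambda>l. scaled_path a (\<lambda>m. z (min m l))) (scaled_path a z) sequentially"
proof (rule limitin_skorokhod_J1I[OF scaled_path_cadlag[OF a]])
  fix T e :: real assume e: "e > 0"
  obtain l0 where l0: "T * a \<le> real l0" using real_arch_simple by blast
  have "scaled_path a (\<lambda>m. z (min m l)) \<in> J1_nhd (scaled_path a z) T e" if l: "l \<ge> l0" for l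
  proof -
    have "nat \<lfloor>t * a\<rfloor> \<le> l" if t: "t \<in> {0..T}" for t
    proof -
      have "t * a \<le> T * a" using t a by (intro mult_right_mono) auto
      hence "\<lfloor>t * a\<rfloor> \<le> int l" using l0 l by linarith
      thus ?thesis by simp
    qed
    thus ?thesis using e scaled_path_cadlag[OF a] id_time_change unfolding J1_nhd_def
      by (auto intro!: bexI[of _ "\<lambda>t. t"] simp: scaled_path_def min_def)
  qed
  thus "\<forall>\<^sub>F l in sequentially. scaled_path a (\<lambda>m. z (min m l)) \<in> J1_nhd (scaled_path a z) T e"
    unfolding eventually_sequentially by blast
qed

lemma measurable_prefix:
  fixes Z :: "nat \<Rightarrow> 'a \<Rightarrow> 'c::countable"
  assumes Z: "\<And>m. Z m \<in> M \<rightarrow>\<^sub>M count_space UNIV"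
  shows "(\<lambda>\<omega>. map (\<lambda>i. Z i \<omega>) [0..<m]) \<in> M \<rightarrow>\<^sub>M count_space UNIV"
proof (induction m)
  case (Suc m)
  have "(\<lambda>\<omega>. (\<lambda>p. fst p @ [snd p]) (map (\<lambda>i. Z i \<omega>) [0..<m], Z m \<omega>)) \<in> M \<rightarrow>\<^sub>M count_space UNIV"
    by (rule measurable_compose[OF measurable_Pair[OF Suc Z]])
       (simp add: pair_measure_countable)
  thus ?case by simp
qed simp

lemma frozen_path_prefix:
  "scaled_path a (\<lambda>m. z (min m l)) = scaled_path a (\<lambda>m. map z [0..<Suc l] ! min m l)"
proof -
  have "map z [0..<Suc l] ! min m l = z (min m l)" for m
    by (subst nth_map) (auto simp del: upt_Suc)
  thus ?thesis by simp
qed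

lemma measurable_frozen_path:
  assumes a: "a \<ge> 0" and Z: "\<And>m. Z m \<in> M \<rightarrow>\<^sub>M count_space UNIV"
  shows "(\<lambda>\<omega>. scaled_path a (\<lambda>m. Z (min m l) \<omega>)) \<in> M \<rightarrow>\<^sub>M borel_of skorokhod_J1"
  unfolding frozen_path_prefix[of a "\<lambda>m. Z m _"]
  by (rule measurable_compose[OF measurable_prefix[OF Z]])
     (auto simp: topspace_skorokhod_J1 scaled_path_cadlag[OF a])

lemma measurable_scaled_path:
  assumes a: "a \<ge> 0" and Z: "\<And>m. Z m \<in> M \<rightarrow>\<^sub>M count_space UNIV"
  shows "(\<lambda>\<omega>. scaled_path a (\<lambda>m. Z m \<omega>)) \<in> M \<rightarrow>\<^sub>M borel_of skorokhod_J1"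
  using measurable_frozen_path[OF assms] scaled_path_freeze[OF a]
  by (rule measurable_J1_limit)

lemma continuous_map_tendsto:
  assumes "continuous_map T euclideanreal \<phi>" "limitin T F f sequentially"
  shows "(\<lambda>n. \<phi> (F n)) \<longlonglongrightarrow> \<phi> f"
  using continuous_map_limit[OF assms] by (simp add: o_def)

lemma integral_J1_limit:
  assumes M: "prob_space M"
    and Z: "\<And>n. Z n \<in> M \<rightarrow>\<^sub>M borel_of skorokhod_J1"
    and lim: "\<And>\<omega>. \<omega> \<in> space M \<Longrightarrow> limitin skorokhod_J1 (\<lambda>n. Z n \<omega>) (R \<omega>) sequentially"
    and \<phi>: "continuous_map skorokhod_J1 euclideanreal \<phi>" "bounded (\<phi> ` topspace skorokhod_J1)"
  shows "(\<lambda>n. \<integral>\<omega>. \<phi> (Z n \<omega>) \<partial>M) \<longlonglongrightarrow> (\<integral>\<omega>. \<phi> (R \<omega>) \<partial>M)"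
proof -
  interpret prob_space M by fact
  obtain b where b: "\<And>x. x \<in> topspace skorokhod_J1 \<Longrightarrow> norm (\<phi> x) \<le> b"
    using \<phi>(2) unfolding bounded_iff by blast
  note meas = measurable_compose[OF _ continuous_map_measurable_borel_of[OF \<phi>(1)]]
  show ?thesis
  proof (rule integral_dominated_convergence[where w = "\<lambda>_. b"])
    show "AE \<omega> in M. (\<lambda>n. \<phi> (Z n \<omega>)) \<longlonglongrightarrow> \<phi> (R \<omega>)"
      using continuous_map_tendsto[OF \<phi>(1) lim] by simp
    show "AE \<omega> in M. norm (\<phi> (Z n \<omega>)) \<le> b" for n
      using b measurable_space[OF Z] by (intro AE_I2) simp
  qed (auto intro: meas[OF Z] meas[OF measurable_J1_limit[OF Z lim]])
qed

lemma integral_frozen_path: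
  assumes Z: "\<And>m. Z m \<in> M \<rightarrow>\<^sub>M count_space UNIV"
  shows "(\<integral>\<omega>. \<phi> (scaled_path a (\<lambda>m. Z (min m l) \<omega>)) \<partial>M) =
      (\<integral>zs. (\<phi> (scaled_path a (\<lambda>m. zs ! min m l)) :: real)
         \<partial>distr M (count_space UNIV) (\<lambda>\<omega>. map (\<lambda>i. Z i \<omega>) [0..<Suc l]))"
  unfolding frozen_path_prefix[of a "\<lambda>m. Z m _"]
  by (rule integral_distr[OF measurable_prefix[where Z = Z, OF Z], symmetric]) simp

lemma integral_frozen_path_tendsto:
  assumes a: "a \<ge> 0" and M: "prob_space M" and Z: "\<And>m. Z m \<in> M \<rightarrow>\<^sub>M count_space UNIV"
    and \<phi>: "continuous_map skorokhod_J1 euclideanreal \<phi>" "bounded (\<phi> ` topspace skorokhod_J1)"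
  shows "(\<lambda>l. \<integral>\<omega>. \<phi> (scaled_path a (\<lambda>m. Z (min m l) \<omega>)) \<partial>M)
           \<longlonglongrightarrow> (\<integral>\<omega>. \<phi> (scaled_path a (\<lambda>m. Z m \<omega>)) \<partial>M)"
proof (rule integral_J1_limit[OF M _ _ \<phi>])
  show "(\<lambda>\<omega>. scaled_path a (\<lambda>m. Z (min m l) \<omega>)) \<in> M \<rightarrow>\<^sub>M borel_of skorokhod_J1" for l
    by (rule measurable_frozen_path[OF a, where Z = Z, OF Z])
  show "limitin skorokhod_J1 (\<lambda>l. scaled_path a (\<lambda>m. Z (min m l) \<omega>))
      (scaled_path a (\<lambda>m. Z m \<omega>)) sequentially" for \<omega>
    by (rule scaled_path_freeze[OF a, where z = "\<lambda>m. Z m \<omega>"])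
qed

text \<open>
  The expectations agree for frozen paths, which are functions of equally distributed prefixes, and
  both sides are limits of such expectations.
\<close>

lemma scaled_path_integral_eq:
  assumes a: "a \<ge> 0" and M: "prob_space M" and N: "prob_space N"
    and Z: "\<And>m. Z m \<in> M \<rightarrow>\<^sub>M count_space UNIV" and W: "\<And>m. W m \<in> N \<rightarrow>\<^sub>M count_space UNIV"
    and law: "\<And>m zs. measure M {\<omega> \<in> space M. map (\<lambda>i. Z i \<omega>) [0..<Suc m] = zs} =
                measure N {\<omega> \<in> space N. map (\<lambda>i. W i \<omega>) [0..<Suc m] = zs}"
    and \<phi>: "continuous_map skorokhod_J1 euclideanreal \<phi>" "bounded (\<phi> ` topspace skorokhod_J1)"
  shows "(\<integral>\<omega>. \<phi> (scaled_path a (\<lambda>m. Z m \<omega>)) \<partial>M) = (\<integral>\<omega>. \<phi> (scaled_path a (\<lambda>m. W m \<omega>)) \<partial>N)"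
proof -
  interpret M: prob_space M by fact
  interpret N: prob_space N by fact
  have distr: "distr M (count_space UNIV) (\<lambda>\<omega>. map (\<lambda>i. Z i \<omega>) [0..<Suc l]) =
        distr N (count_space UNIV) (\<lambda>\<omega>. map (\<lambda>i. W i \<omega>) [0..<Suc l])" for l
  proof (rule measure_eqI_countable[where A = UNIV])
    fix zs
    have "emeasure M ((\<lambda>\<omega>. map (\<lambda>i. Z i \<omega>) [0..<Suc l]) -` {zs} \<inter> space M)
        = emeasure N ((\<lambda>\<omega>. map (\<lambda>i. W i \<omega>) [0..<Suc l]) -` {zs} \<inter> space N)"
      using law[of l zs] unfolding M.emeasure_eq_measure N.emeasure_eq_measure
      by (simp add: vimage_def Int_def conj_commute del: upt_Suc)
    thus "emeasure (distr M (count_space UNIV) (\<lambda>\<omega>. map (\<lambda>i. Z i \<omega>) [0..<Suc l])) {zs} =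
        emeasure (distr N (count_space UNIV) (\<lambda>\<omega>. map (\<lambda>i. W i \<omega>) [0..<Suc l])) {zs}"
      using measurable_prefix[OF Z] measurable_prefix[OF W] by (simp add: emeasure_distr del: upt_Suc)
  qed auto
  have eq: "(\<integral>\<omega>. \<phi> (scaled_path a (\<lambda>m. Z (min m l) \<omega>)) \<partial>M) =
      (\<integral>\<omega>. \<phi> (scaled_path a (\<lambda>m. W (min m l) \<omega>)) \<partial>N)" for l
    by (simp only: integral_frozen_path[where Z = Z, OF Z] integral_frozen_path[where Z = W, OF W] distr)
  show ?thesis
    using integral_frozen_path_tendsto[OF a M, where Z = Z, OF Z \<phi>]
      integral_frozen_path_tendsto[OF a N, where Z = W, OF W \<phi>]
    unfolding eq by (rule LIMSEQ_unique)
qed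

section \<open>Loop erasure after one more step\<close>

text \<open>
  This is the number of indices \<open>\<lambda>\<^sub>i\<close> that fall on the path, hence the length of the loop erasure. The
  indices \<open>\<lambda>\<^sub>0 < \<lambda>\<^sub>1 < \<dots>\<close> increase up to \<open>length x\<close>, which is the value at \<open>le_count x\<close>.
\<close>

abbreviation le_count :: "'v list \<Rightarrow> nat" where
  "le_count x \<equiv> (LEAST i. length x \<le> le_index x i)"

lemma visits:
  assumes "t < length x"
  shows "t \<le> Max {s. s < length x \<and> x ! s = x ! t}"
    "Max {s. s < length x \<and> x ! s = x ! t} < length x"
    "x ! Max {s. s < length x \<and> x ! s = x ! t} = x ! t"
proof -
  have f: "finite {s. s < length x \<and> x ! s = x ! t}" by simp
  show "t \<le> Max {s. s < length x \<and> x ! s = x ! t}" using f assms by (intro Max_ge) auto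
  have "Max {s. s < length x \<and> x ! s = x ! t} \<in> {s. s < length x \<and> x ! s = x ! t}"
    using f assms by (intro Max_in) auto
  thus "Max {s. s < length x \<and> x ! s = x ! t} < length x"
    "x ! Max {s. s < length x \<and> x ! s = x ! t} = x ! t" by auto
qed

lemma le_index_step:
  assumes "le_index x i < length x"
  shows "le_index x i < le_index x (Suc i)" "le_index x (Suc i) \<le> length x"
  using visits(1,2)[OF assms] by auto

lemma le_count_exists: "\<exists>i. length x \<le> le_index x i"
proof (rule ccontr)
  assume "\<not> ?thesis"
  hence *: "le_index x i < length x" for i by (simp add: not_le)
  have "i \<le> le_index x i" for i
  proof (induction i)
    case (Suc i) thus ?case using le_index_step(1)[OF *[of i]] by linarith
  qed simp
  from this[of "length x"] *[of "length x"] show False by simp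
qed

lemma le_index_less: "i < le_count x \<Longrightarrow> le_index x i < length x"
  using not_less_Least[of i "\<lambda>i. length x \<le> le_index x i"] by simp

lemma le_index_le: "i \<le> le_count x \<Longrightarrow> le_index x i \<le> length x"
proof (cases i)
  case (Suc j)
  assume "i \<le> le_count x"
  thus ?thesis using le_index_step(2)[OF le_index_less, of j x] Suc by simp
qed simp

lemma le_index_le_count: "le_index x (le_count x) = length x"
  using LeastI_ex[OF le_count_exists[of x]] le_index_le[of "le_count x" x] by simp

lemma le_index_strict_mono:
  assumes "i < j" "j \<le> le_count x"
  shows "le_index x i < le_index x j"
  using assms
proof (induction j)
  case (Suc j)
  have "le_index x j < le_index x (Suc j)" using le_index_step(1)[OF le_index_less, of j x] Suc.prems
    by (simp del: le_index.simps)
  thus ?case using Suc by (cases "i = j") (auto simp del: le_index.simps)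
qed simp

lemma le_count_eqI:
  assumes "le_index x m = length x" "\<And>i. i < m \<Longrightarrow> le_index x i < length x"
  shows "le_count x = m"
  using assms by (intro Least_equality) (auto simp: not_le[symmetric])

lemma length_loop_erasure: "length (loop_erasure x) = le_count x"
  by (simp add: loop_erasure_def)

lemma nth_loop_erasure: "i < le_count x \<Longrightarrow> loop_erasure x ! i = x ! le_index x i"
  by (simp add: loop_erasure_def)

lemma last_visit_loop_erasure:
  assumes "i < le_count x"
  shows "last_visit x (loop_erasure x ! i) + 1 = le_index x (Suc i)"
  using assms by (simp add: last_visit_def nth_loop_erasure)

text \<open>
  The last visit to the \<open>i\<close>-th vertex of the loop erasure is at time \<open>\<lambda>\<^sub>i\<^sub>+\<^sub>1 - 1\<close>. So the vertex
  visited latest is the one that comes last along the loop erasure.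
\<close>

lemma last_visit_strict_mono:
  assumes "i < j" "j < length (loop_erasure x)"
  shows "last_visit x (loop_erasure x ! i) < last_visit x (loop_erasure x ! j)"
  using assms last_visit_loop_erasure[of i x] last_visit_loop_erasure[of j x]
    le_index_strict_mono[of "Suc i" "Suc j" x] by (simp add: length_loop_erasure)

lemma distinct_loop_erasure: "distinct (loop_erasure x)"
  unfolding distinct_conv_nth
  by (metis last_visit_strict_mono linorder_neqE_nat less_irrefl)

lemma set_loop_erasure: "set (loop_erasure x) \<subseteq> set x"
  using le_index_less by (fastforce simp: loop_erasure_def)

text \<open>
  Appending \<open>v\<close> changes the last visit to \<open>v\<close> only, so the indices agree until the loop erasure
  meets \<open>v\<close>.
\<close>

lemma le_index_append:
  assumes "j \<le> le_count x" "\<And>i. i < j \<Longrightarrow> v \<noteq> loop_erasure x ! i"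
  shows "le_index (x @ [v]) j = le_index x j"
  using assms
proof (induction j)
  case (Suc j)
  have less: "le_index x j < length x" using Suc.prems le_index_less[of j x] by simp
  have v: "v \<noteq> x ! le_index x j" using Suc.prems nth_loop_erasure[of j x] by force
  have "{t. t < length (x @ [v]) \<and> (x @ [v]) ! t = (x @ [v]) ! le_index x j} =
      {t. t < length x \<and> x ! t = x ! le_index x j}"
    using less v by (auto simp: nth_append less_Suc_eq)
  thus ?case using Suc by simp
qed simp

lemma le_index_append_revisit:
  assumes "le_index (x @ [v]) j = t" "t \<le> length x" "(x @ [v]) ! t = v"
  shows "le_index (x @ [v]) (Suc j) = length (x @ [v])"
proof -
  have "Max {s. s < length (x @ [v]) \<and> (x @ [v]) ! s = v} = length x"
    by (rule Max_eqI) auto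
  thus ?thesis using assms by simp
qed

lemma loop_erasure_append_new:
  assumes "v \<notin> set (loop_erasure x)"
  shows "length (loop_erasure (x @ [v])) = Suc (length (loop_erasure x))"
proof -
  have ne: "v \<noteq> loop_erasure x ! i" if "i < le_count x" for i
    using assms that nth_mem[of i "loop_erasure x"] by (auto simp: length_loop_erasure)
  have eq: "le_index (x @ [v]) j = le_index x j" if "j \<le> le_count x" for j
    using that ne by (intro le_index_append) auto
  have "le_count (x @ [v]) = Suc (le_count x)"
  proof (rule le_count_eqI)
    show "le_index (x @ [v]) (Suc (le_count x)) = length (x @ [v])"
      by (rule le_index_append_revisit[OF eq]) (auto simp: le_index_le_count)
    show "le_index (x @ [v]) i < length (x @ [v])" if "i < Suc (le_count x)" for i
      using that eq[of i] le_index_le[of i x] by simp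
  qed
  thus ?thesis by (simp add: length_loop_erasure)
qed

lemma loop_erasure_append_old:
  assumes j: "j < length (loop_erasure x)"
  shows "length (loop_erasure (x @ [loop_erasure x ! j])) = Suc j"
proof -
  let ?v = "loop_erasure x ! j"
  have j': "j < le_count x" using j by (simp add: length_loop_erasure)
  have ne: "?v \<noteq> loop_erasure x ! i" if "i < j" for i
    using that j nth_eq_iff_index_eq[OF distinct_loop_erasure[of x], of j i] by simp
  have eq: "le_index (x @ [?v]) i = le_index x i" if "i \<le> j" for i
    using that j' ne by (intro le_index_append) auto
  have "le_count (x @ [?v]) = Suc j"
  proof (rule le_count_eqI)
    have "le_index x j < length x" using j' le_index_less by blast
    thus "le_index (x @ [?v]) (Suc j) = length (x @ [?v])"
      by (intro le_index_append_revisit[OF eq[OF order_refl]]) (auto simp: nth_append nth_loop_erasure[OF j'])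
    show "le_index (x @ [?v]) i < length (x @ [?v])" if "i < Suc j" for i
      using that j' eq[of i] le_index_less[of i x] by simp
  qed
  thus ?thesis by (simp add: length_loop_erasure)
qed

lemma arg_max_last_visit:
  fixes x ys :: "'v list"
  assumes "ys \<noteq> []"
  defines "v \<equiv> ARG_MAX (last_visit x) v. v \<in> set ys"
  shows "v \<in> set ys" "y \<in> set ys \<Longrightarrow> last_visit x y \<le> last_visit x v"
proof -
  have bd: "\<forall>y. y \<in> set ys \<longrightarrow> last_visit x y < Suc (Max (last_visit x ` set ys))"
    by (simp add: le_imp_less_Suc)
  have "hd ys \<in> set ys" using assms(1) by simp
  from arg_max_nat_lemma[of "\<lambda>v. v \<in> set ys", OF this bd]
  show "v \<in> set ys" "y \<in> set ys \<Longrightarrow> last_visit x y \<le> last_visit x v" by (auto simp: v_def)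
qed

lemma max_choice_new:
  assumes "\<exists>l<length ys. ys ! l \<notin> set (loop_erasure x)"
  shows "max_choice x ys \<in> set ys" "max_choice x ys \<notin> set (loop_erasure x)"
proof -
  have "max_choice x ys = ys ! (LEAST l. l < length ys \<and> ys ! l \<notin> set (loop_erasure x))"
    unfolding max_choice_def Let_def by (rule if_P[OF assms])
  thus "max_choice x ys \<in> set ys" "max_choice x ys \<notin> set (loop_erasure x)"
    using LeastI_ex[OF assms] by auto
qed

lemma max_choice_old:
  assumes "\<not> (\<exists>l<length ys. ys ! l \<notin> set (loop_erasure x))"
  shows "max_choice x ys = (ARG_MAX (last_visit x) v. v \<in> set ys)"
  unfolding max_choice_def Let_def by (rule if_not_P[OF assms])

lemma max_choice_in_set: "ys \<noteq> [] \<Longrightarrow> max_choice x ys \<in> set ys"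
  using max_choice_new(1) max_choice_old arg_max_last_visit(1) by metis

text \<open>
  If some sample is new, the loop erasure grows, and that sample is not among the first \<open>j\<close> vertices.
  Otherwise the loop erasure is cut behind the sample that comes last along it, so its new length is
  at most \<open>j\<close> iff this sample, and with it every other one, is among the first \<open>j\<close> vertices.
\<close>

lemma length_loop_erasure_max_choice_le_iff:
  assumes "ys \<noteq> []" and j: "j \<le> length (loop_erasure x)"
  shows "length (loop_erasure (x @ [max_choice x ys])) \<le> j \<longleftrightarrow> set ys \<subseteq> set (take j (loop_erasure x))"
proof (cases "\<exists>l<length ys. ys ! l \<notin> set (loop_erasure x)")
  case True
  have "length (loop_erasure (x @ [max_choice x ys])) = Suc (length (loop_erasure x))"
    by (rule loop_erasure_append_new[OF max_choice_new(2)[OF True]])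
  moreover have "\<not> set ys \<subseteq> set (take j (loop_erasure x))"
    using True set_take_subset[of j "loop_erasure x"] nth_mem by blast
  ultimately show ?thesis using j by simp
next
  case False
  hence sub: "set ys \<subseteq> set (loop_erasure x)" by (auto simp: in_set_conv_nth[of _ ys])
  let ?v = "ARG_MAX (last_visit x) v. v \<in> set ys"
  have v: "max_choice x ys = ?v" by (rule max_choice_old[OF False])
  have vin: "?v \<in> set ys" and vmax: "\<And>y. y \<in> set ys \<Longrightarrow> last_visit x y \<le> last_visit x ?v"
    using arg_max_last_visit[OF assms(1)] by auto
  obtain p where p: "p < length (loop_erasure x)" "?v = loop_erasure x ! p"
    using vin sub by (metis in_set_conv_nth subset_iff)
  have len: "length (loop_erasure (x @ [max_choice x ys])) = Suc p"
    unfolding v p(2) by (rule loop_erasure_append_old[OF p(1)])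
  have in_take: "loop_erasure x ! q \<in> set (take j (loop_erasure x)) \<longleftrightarrow> q < j"
    if "q < length (loop_erasure x)" for q
    using that j nth_eq_iff_index_eq[OF distinct_loop_erasure[of x]]
    by (auto simp: in_set_conv_nth)
  show ?thesis
  proof
    assume "length (loop_erasure (x @ [max_choice x ys])) \<le> j"
    hence pj: "p < j" using len by simp
    show "set ys \<subseteq> set (take j (loop_erasure x))"
    proof
      fix y assume y: "y \<in> set ys"
      then obtain q where q: "q < length (loop_erasure x)" "y = loop_erasure x ! q"
        using sub by (metis in_set_conv_nth subset_iff)
      have "q \<le> p" using vmax[OF y] last_visit_strict_mono[of p q x] q p by force
      thus "y \<in> set (take j (loop_erasure x))" using in_take[OF q(1)] q pj by simp
    qed
  next
    assume "set ys \<subseteq> set (take j (loop_erasure x))"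
    thus "length (loop_erasure (x @ [max_choice x ys])) \<le> j"
      using vin in_take[OF p(1)] p len by auto
  qed
qed

lemma length_loop_erasure_append_le: "length (loop_erasure (x @ [v])) \<le> Suc (length (loop_erasure x))"
proof (cases "v \<in> set (loop_erasure x)")
  case True
  then obtain j where "j < length (loop_erasure x)" "v = loop_erasure x ! j"
    by (metis in_set_conv_nth)
  thus ?thesis using loop_erasure_append_old[of j x] by simp
qed (simp add: loop_erasure_append_new)

section \<open>The length chain and its transition law\<close>

lemma prob_replicate_pmf_subset:
  assumes "countable A"
  shows "measure (measure_pmf (replicate_pmf k p)) {ys. set ys \<subseteq> A} = measure (measure_pmf p) A ^ k"
proof (induction k)
  case (Suc k)
  have "replicate_pmf (Suc k) p = map_pmf (\<lambda>(y, ys). y # ys) (pair_pmf p (replicate_pmf k p))"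
    by (simp add: pair_pmf_def map_pmf_def bind_assoc_pmf bind_return_pmf)
  moreover have "(\<lambda>(y, ys). y # ys) -` {ys. set ys \<subseteq> A} = A \<times> {ys. set ys \<subseteq> A}" by auto
  moreover have "countable {ys. set ys \<subseteq> A}" using assms by (simp flip: lists_eq_set)
  ultimately show ?case using Suc assms
    by (simp add: measure_pmf_prob_product del: vimage_Collect_eq vimage_Collect)
qed simp

lemma nat_law_from_cdf:
  fixes q :: "nat pmf"
  assumes M: "prob_space M" and Z: "Z \<in> M \<rightarrow>\<^sub>M count_space UNIV"
    and cdf: "\<And>j. measure M {\<omega> \<in> space M. Z \<omega> \<le> j} = measure (measure_pmf q) {..j}"
  shows "measure M {\<omega> \<in> space M. Z \<omega> = b} = pmf q b"
proof -
  interpret prob_space M by fact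
  have sets: "{\<omega> \<in> space M. Z \<omega> \<in> A} \<in> sets M" for A
    using measurable_sets[OF Z, of A] by (simp add: vimage_def Int_def conj_commute)
  show ?thesis
  proof (cases b)
    case 0
    have "{..0::nat} = {0}" by auto
    thus ?thesis using cdf[of 0] 0 by (simp add: pmf.rep_eq)
  next
    case (Suc c)
    have "measure M ({\<omega> \<in> space M. Z \<omega> \<in> {..c}} \<union> {\<omega> \<in> space M. Z \<omega> \<in> {b}}) =
        measure M {\<omega> \<in> space M. Z \<omega> \<in> {..c}} + measure M {\<omega> \<in> space M. Z \<omega> \<in> {b}}"
      by (rule finite_measure_Union[OF sets sets]) (auto simp: Suc)
    moreover have "{\<omega> \<in> space M. Z \<omega> \<in> {..c}} \<union> {\<omega> \<in> space M. Z \<omega> \<in> {b}} = {\<omega> \<in> space M. Z \<omega> \<le> b}"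
      by (auto simp: Suc)
    moreover have "measure (measure_pmf q) ({..c} \<union> {b}) = measure (measure_pmf q) {..c} + pmf q b"
      by (subst measure_pmf.finite_measure_Union) (auto simp: Suc pmf.rep_eq)
    moreover have "{..c} \<union> {b} = {..b}" by (auto simp: Suc)
    ultimately show ?thesis using cdf[of b] cdf[of c] by simp
  qed
qed

lemma pmf_nat_eqI:
  fixes p q :: "nat pmf"
  assumes "\<And>j. measure (measure_pmf p) {..j} = measure (measure_pmf q) {..j}"
  shows "p = q"
proof (rule pmf_eqI)
  fix b
  have "measure (measure_pmf p) {u \<in> space (measure_pmf p). u = b} = pmf q b"
    by (rule nat_law_from_cdf[OF prob_space_measure_pmf]) (use assms in \<open>auto simp: atMost_def\<close>)
  thus "pmf p b = pmf q b" by (simp add: pmf.rep_eq)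
qed

text \<open>
  The law of the maximum of \<open>k\<close> independent uniform ranks in \<open>{1..n}\<close>; the shift by one is due to the
  vertices being numbered from zero.
\<close>

definition top_rank_pmf :: "nat \<Rightarrow> nat \<Rightarrow> nat pmf" where
  "top_rank_pmf k n = map_pmf (\<lambda>ys. Suc (Max (set ys))) (replicate_pmf k (pmf_of_set {..<n}))"

lemma top_rank_cdf:
  assumes k: "k \<ge> 1" and j: "j \<le> n" and n: "n \<ge> 1"
  shows "measure (measure_pmf (top_rank_pmf k n)) {..j} = (real j / real n) ^ k"
proof -
  have ne: "{..<n} \<noteq> {}" using n by (simp add: lessThan_empty_iff bot_nat_def)
  have "measure (measure_pmf (top_rank_pmf k n)) {..j} =
      measure (measure_pmf (replicate_pmf k (pmf_of_set {..<n}))) {ys. Suc (Max (set ys)) \<le> j}"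
    by (simp add: top_rank_pmf_def vimage_def)
  also have "\<dots> = measure (measure_pmf (replicate_pmf k (pmf_of_set {..<n}))) {ys. set ys \<subseteq> {..<j}}"
  proof (rule measure_pmf.finite_measure_eq_AE)
    show "AE ys in measure_pmf (replicate_pmf k (pmf_of_set {..<n})).
        ys \<in> {ys. Suc (Max (set ys)) \<le> j} \<longleftrightarrow> ys \<in> {ys. set ys \<subseteq> {..<j}}"
    proof (rule AE_pmfI)
      fix ys assume "ys \<in> set_pmf (replicate_pmf k (pmf_of_set {..<n}))"
      hence "ys \<noteq> []" using k by (auto simp: set_replicate_pmf)
      thus "ys \<in> {ys. Suc (Max (set ys)) \<le> j} \<longleftrightarrow> ys \<in> {ys. set ys \<subseteq> {..<j}}"
        by (auto simp: Suc_le_eq)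
    qed
  qed auto
  also have "\<dots> = (real j / real n) ^ k"
  proof -
    have "{..<n} \<inter> {..<j} = {..<j}" using j by auto
    thus ?thesis
      by (simp add: prob_replicate_pmf_subset countable_finite measure_pmf_of_set[OF ne finite_lessThan])
  qed
  finally show ?thesis .
qed

text \<open>
  Both distribution functions equal \<open>(j / n) ^ k\<close> at every \<open>j\<close> up to the current length, since the
  first \<open>j\<close> vertices of the loop erasure are \<open>j\<close> distinct vertices among \<open>n\<close>, and \<open>1\<close> beyond it. The
  law depends on the path through the length of its loop erasure only, which makes the length a
  Markov chain.
\<close>

lemma step_law:
  assumes k: "k \<ge> 1" and x: "set x \<subseteq> {..<n}" and n: "n \<ge> 1"
  shows "map_pmf (\<lambda>v. length (loop_erasure (x @ [v])))
           (map_pmf (max_choice x) (replicate_pmf k (pmf_of_set {..<n}))) =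
         map_pmf (\<lambda>u. min (Suc (length (loop_erasure x))) u) (top_rank_pmf k n)"
    (is "?p = ?q")
proof (rule pmf_nat_eqI)
  fix j
  let ?L = "loop_erasure x" and ?r = "replicate_pmf k (pmf_of_set {..<n})"
  have ne: "{..<n} \<noteq> {}" using n by (simp add: lessThan_empty_iff bot_nat_def)
  have p: "measure (measure_pmf ?p) {..j} =
      measure (measure_pmf ?r) {ys. length (loop_erasure (x @ [max_choice x ys])) \<le> j}"
    by (simp add: vimage_def)
  have q: "measure (measure_pmf ?q) {..j} = measure (measure_pmf (top_rank_pmf k n)) {u. min (Suc (length ?L)) u \<le> j}"
    by (simp add: vimage_def)
  show "measure (measure_pmf ?p) {..j} = measure (measure_pmf ?q) {..j}"
  proof (cases "j \<le> length ?L")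
    case False
    have "length (loop_erasure (x @ [max_choice x ys])) \<le> j" for ys
      using False length_loop_erasure_append_le[of x "max_choice x ys"] by simp
    hence "{ys. length (loop_erasure (x @ [max_choice x ys])) \<le> j} = UNIV" by simp
    moreover have "{u. min (Suc (length ?L)) u \<le> j} = UNIV" using False by auto
    ultimately show ?thesis unfolding p q by simp
  next
    case True
    have sub: "set (take j ?L) \<subseteq> {..<n}" using set_take_subset set_loop_erasure x by fastforce
    have card: "card (set (take j ?L)) = j"
      using True distinct_card[OF distinct_take[OF distinct_loop_erasure], of j x] by simp
    hence jn: "j \<le> n" using card_mono[OF finite_lessThan sub] by simp
    have "measure (measure_pmf ?p) {..j} = measure (measure_pmf ?r) {ys. set ys \<subseteq> set (take j ?L)}"
      unfolding p
    proof (rule measure_pmf.finite_measure_eq_AE)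
      show "AE ys in measure_pmf ?r. ys \<in> {ys. length (loop_erasure (x @ [max_choice x ys])) \<le> j} \<longleftrightarrow>
          ys \<in> {ys. set ys \<subseteq> set (take j ?L)}"
      proof (rule AE_pmfI)
        fix ys assume "ys \<in> set_pmf ?r"
        hence "ys \<noteq> []" using k by (auto simp: set_replicate_pmf)
        thus "ys \<in> {ys. length (loop_erasure (x @ [max_choice x ys])) \<le> j} \<longleftrightarrow>
            ys \<in> {ys. set ys \<subseteq> set (take j ?L)}"
          using length_loop_erasure_max_choice_le_iff[OF _ True] by simp
      qed
    qed auto
    also have "\<dots> = (real j / real n) ^ k"
      unfolding prob_replicate_pmf_subset[OF countable_finite[OF finite_set]] measure_pmf_of_set[OF ne finite_lessThan]
      by (simp add: Int_absorb1[OF sub] card)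
    also have "\<dots> = measure (measure_pmf (top_rank_pmf k n)) {..j}"
      using top_rank_cdf[OF k jn n] by simp
    also have "\<dots> = measure (measure_pmf (top_rank_pmf k n)) {u. min (Suc (length ?L)) u \<le> j}"
      using True by (intro arg_cong[where f = "measure _"]) auto
    finally show ?thesis unfolding q .
  qed
qed

lemma walk_measurable:
  assumes "maximal_choice_walk k n M X"
  shows "X m \<in> M \<rightarrow>\<^sub>M count_space UNIV"
proof -
  have "(\<lambda>v. v) \<in> count_space {..<n} \<rightarrow>\<^sub>M count_space UNIV" by simp
  thus ?thesis using assms measurable_compose unfolding maximal_choice_walk_def by blast
qed

lemma le_length_measurable:
  assumes "maximal_choice_walk k n M X"
  shows "le_length X m \<in> M \<rightarrow>\<^sub>M count_space UNIV"
  unfolding le_length_def[abs_def]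
  by (rule measurable_compose[OF measurable_prefix[where Z = X, OF walk_measurable[OF assms]]]) simp

text \<open>
  The lengths up to time \<open>m\<close> are a function of the vertices up to time \<open>m\<close>. Splitting the event
  according to these vertices and the next one, each piece is given by the conditional law of the
  walk, and by \<open>step_law\<close> the transition factor is the same for all vertex sequences with the given
  lengths.
\<close>

lemma le_length_Suc_law:
  assumes k: "k \<ge> 1" and n: "n \<ge> 1" and walk: "maximal_choice_walk k n M X"
    and zs: "length zs = Suc m"
  shows "measure M {\<omega> \<in> space M. map (\<lambda>i. le_length X i \<omega>) [0..<Suc (Suc m)] = zs @ [b]} =
     measure M {\<omega> \<in> space M. map (\<lambda>i. le_length X i \<omega>) [0..<Suc m] = zs} *
       pmf (map_pmf (min (Suc (last zs))) (top_rank_pmf k n)) b"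
proof -
  interpret prob_space M using walk by (simp add: maximal_choice_walk_def)
  let ?path = "\<lambda>\<omega>. map (\<lambda>i. X i \<omega>) [0..<Suc m]"
  define lens where "lens x = map (\<lambda>i. length (loop_erasure (take (Suc i) x))) [0..<Suc m]" for x :: "nat list"
  define F where "F = {x. set x \<subseteq> {..<n} \<and> length x = Suc m}"
  define V where "V x = {v. v < n \<and> length (loop_erasure (x @ [v])) = b}" for x
  define E where "E x v = {\<omega> \<in> space M. ?path \<omega> = x \<and> X (Suc m) \<omega> = v}" for x v
  have finF: "finite F" unfolding F_def by (rule finite_lists_length_eq) simp
  have finV: "finite (V x)" for x by (simp add: V_def)
  have X: "X i \<omega> < n" if "\<omega> \<in> space M" for i \<omega>
    using walk that measurable_space[of "X i" M "count_space {..<n}"] by (simp add: maximal_choice_walk_def)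
  have path: "?path \<omega> \<in> F" if "\<omega> \<in> space M" for \<omega> using X[OF that] by (auto simp: F_def)
  have lens: "map (\<lambda>i. le_length X i \<omega>) [0..<Suc m] = lens (?path \<omega>)" for \<omega>
    by (auto simp: lens_def le_length_def take_map simp del: upt_Suc)
  have Pmeas: "{\<omega> \<in> space M. ?path \<omega> = x} \<in> sets M" for x
    using measurable_sets[OF measurable_prefix[where Z = X and m = "Suc m", OF walk_measurable[OF walk]], of "{x}"]
    by (simp add: vimage_def Int_def conj_commute del: upt_Suc)
  have Emeas: "E x v \<in> sets M" for x v
  proof -
    have "{\<omega> \<in> space M. X (Suc m) \<omega> = v} \<in> sets M"
      using measurable_sets[OF walk_measurable[OF walk, of "Suc m"], of "{v}"]
      by (simp add: vimage_def Int_def conj_commute)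
    from sets.Int[OF Pmeas[of x] this] show ?thesis
      by (simp add: E_def Int_def conj_ac cong: conj_cong del: upt_Suc)
  qed
  have "{\<omega> \<in> space M. map (\<lambda>i. le_length X i \<omega>) [0..<Suc (Suc m)] = zs @ [b]} =
      (\<Union>p\<in>(SIGMA x:{x\<in>F. lens x = zs}. V x). E (fst p) (snd p))" (is "?A = ?B")
  proof -
    have "map (\<lambda>i. le_length X i \<omega>) [0..<Suc (Suc m)] = zs @ [b] \<longleftrightarrow>
        lens (?path \<omega>) = zs \<and> length (loop_erasure (?path \<omega> @ [X (Suc m) \<omega>])) = b" for \<omega>
      using lens[of \<omega>] by (simp add: le_length_def)
    thus ?thesis using X path by (auto simp: E_def V_def simp del: upt_Suc)
  qed
  hence "measure M ?A = (\<Sum>p\<in>(SIGMA x:{x\<in>F. lens x = zs}. V x). measure M (E (fst p) (snd p)))"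
    by (simp only:, intro finite_measure_finite_Union)
       (use finF finV Emeas in \<open>auto simp: disjoint_family_on_def E_def\<close>)
  also have "\<dots> = (\<Sum>x\<in>{x\<in>F. lens x = zs}. \<Sum>v\<in>V x. measure M (E x v))"
    using finF finV by (subst sum.Sigma) (auto simp: case_prod_unfold)
  also have "\<dots> = (\<Sum>x\<in>{x\<in>F. lens x = zs}. measure M {\<omega> \<in> space M. ?path \<omega> = x} *
      pmf (map_pmf (min (Suc (last zs))) (top_rank_pmf k n)) b)"
  proof (rule sum.cong[OF refl])
    fix x assume x: "x \<in> {x\<in>F. lens x = zs}"
    let ?r = "map_pmf (max_choice x) (replicate_pmf k (pmf_of_set {..<n}))"
    have last: "last zs = length (loop_erasure x)" using x by (auto simp: lens_def F_def)
    have ne: "{..<n} \<noteq> {}" using n by (simp add: lessThan_empty_iff bot_nat_def)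
    have sub: "set_pmf ?r \<subseteq> {..<n}" unfolding set_map_pmf
    proof (rule image_subsetI)
      fix ys assume "ys \<in> set_pmf (replicate_pmf k (pmf_of_set {..<n}))"
      hence "set ys \<subseteq> {..<n}" "ys \<noteq> []" using k ne by (auto simp: set_replicate_pmf)
      thus "max_choice x ys \<in> {..<n}" using max_choice_in_set by blast
    qed
    have "(\<Sum>v\<in>V x. measure M (E x v)) = (\<Sum>v\<in>V x. measure M {\<omega> \<in> space M. ?path \<omega> = x} * pmf ?r v)"
      using walk by (simp add: maximal_choice_walk_def E_def del: upt_Suc)
    also have "\<dots> = measure M {\<omega> \<in> space M. ?path \<omega> = x} * measure (measure_pmf ?r) (V x)"
      by (simp only: measure_measure_pmf_finite[OF finV] sum_distrib_left)
    also have "measure (measure_pmf ?r) (V x) =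
        measure (measure_pmf ?r) {v. length (loop_erasure (x @ [v])) = b}"
      using sub by (intro measure_pmf.finite_measure_eq_AE AE_pmfI) (auto simp: V_def)
    also have "\<dots> = pmf (map_pmf (\<lambda>v. length (loop_erasure (x @ [v]))) ?r) b"
      by (simp add: pmf.rep_eq vimage_def)
    also have "\<dots> = pmf (map_pmf (min (Suc (last zs))) (top_rank_pmf k n)) b"
      using x unfolding last by (subst step_law[OF k _ n]) (auto simp: F_def)
    finally show "(\<Sum>v\<in>V x. measure M (E x v)) = measure M {\<omega> \<in> space M. ?path \<omega> = x} *
      pmf (map_pmf (min (Suc (last zs))) (top_rank_pmf k n)) b" .
  qed
  also have "\<dots> = (\<Sum>x\<in>{x\<in>F. lens x = zs}. measure M {\<omega> \<in> space M. ?path \<omega> = x}) *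
      pmf (map_pmf (min (Suc (last zs))) (top_rank_pmf k n)) b"
    by (simp only: sum_distrib_right)
  also have "(\<Sum>x\<in>{x\<in>F. lens x = zs}. measure M {\<omega> \<in> space M. ?path \<omega> = x}) =
      measure M (\<Union>x\<in>{x\<in>F. lens x = zs}. {\<omega> \<in> space M. ?path \<omega> = x})"
    by (rule finite_measure_finite_Union[symmetric])
       (use finF Pmeas in \<open>auto simp: disjoint_family_on_def\<close>)
  also have "(\<Union>x\<in>{x\<in>F. lens x = zs}. {\<omega> \<in> space M. ?path \<omega> = x}) =
      {\<omega> \<in> space M. map (\<lambda>i. le_length X i \<omega>) [0..<Suc m] = zs}"
    using path lens by auto
  finally show ?thesis .
qed

section \<open>Time changes and Rayleigh paths\<close>

text \<open>
  The time change is the identity plus a sum of small hat functions \<open>h s\<close> centred at the points \<open>s\<close> of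
  \<open>D\<close>. The hats have radius at most the distance between any two points of \<open>D\<close> and between any point
  of \<open>D\<close> and the origin, so that the prescribed shifts do not interfere and the origin stays fixed.
  For small shifts the perturbation is Lipschitz with constant \<open>1 / 2\<close>, hence the sum is increasing.
\<close>

lemma time_change_shifting:
  fixes D :: "real set"
  assumes D: "finite D" "D \<subseteq> {0<..}" and e: "e > 0"
  obtains \<delta> where "\<delta> > 0"
    "\<And>d. (\<And>s. s \<in> D \<Longrightarrow> 0 \<le> d s \<and> d s \<le> \<delta>) \<Longrightarrow>
       \<exists>\<tau>\<in>time_changes. (\<forall>t\<ge>0. \<bar>\<tau> t - t\<bar> < e) \<and> (\<forall>s\<in>D. \<tau> s = s + d s)"
proof -
  obtain r where r: "r > 0" "\<And>s. s \<in> D \<Longrightarrow> r \<le> s" "\<And>s s'. s \<in> D \<Longrightarrow> s' \<in> D \<Longrightarrow> s \<noteq> s' \<Longrightarrow> r \<le> \<bar>s - s'\<bar>"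
  proof -
    define G where "G = insert 1 (D \<union> (\<lambda>(s, s'). \<bar>s - s'\<bar>) ` {(s, s'). s \<in> D \<and> s' \<in> D \<and> s \<noteq> s'})"
    have "{(s, s'). s \<in> D \<and> s' \<in> D \<and> s \<noteq> s'} \<subseteq> D \<times> D" by auto
    hence G: "finite G" unfolding G_def using D(1) finite_subset by blast
    have "\<And>g. g \<in> G \<Longrightarrow> g > 0" using D(2) by (auto simp: G_def)
    hence "Min G > 0" using G by (simp add: G_def)
    moreover have "Min G \<le> g" if "g \<in> G" for g using G that by simp
    moreover have "s \<in> G" if "s \<in> D" for s using that by (simp add: G_def)
    moreover have "\<bar>s - s'\<bar> \<in> G" if "s \<in> D" "s' \<in> D" "s \<noteq> s'" for s s'
      using that unfolding G_def by (intro insertI2 UnI2 image_eqI[of _ _ "(s, s')"]) auto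
    ultimately show thesis using that[of "Min G"] by blast
  qed
  define h where "h s t = max 0 (1 - \<bar>t - s\<bar> / r)" for s t :: real
  have h: "0 \<le> h s t" "h s t \<le> 1" "\<bar>h s t - h s u\<bar> \<le> \<bar>t - u\<bar> / r" for s t u
  proof -
    show "0 \<le> h s t" "h s t \<le> 1" using r(1) by (auto simp: h_def)
    have "\<bar>\<bar>u - s\<bar> / r - \<bar>t - s\<bar> / r\<bar> \<le> \<bar>t - u\<bar> / r"
      using r(1) by (auto simp: divide_right_mono simp flip: diff_divide_distrib)
    thus "\<bar>h s t - h s u\<bar> \<le> \<bar>t - u\<bar> / r" by (auto simp: h_def max_def)
  qed
  have h_other: "h s t = 0" if "r \<le> \<bar>t - s\<bar>" for s t
    using that r(1) by (simp add: h_def)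
  define c where "c = real (card D) + 1"
  have c: "c > 0" "real (card D) < c" by (auto simp: c_def)
  define \<delta> where "\<delta> = min r e / (2 * c)"
  have \<delta>: "\<delta> > 0" using r(1) e c by (simp add: \<delta>_def)
  have \<delta>c: "real (card D) * \<delta> \<le> min r e / 2"
  proof -
    have "real (card D) * \<delta> \<le> c * \<delta>" using \<delta> c by (intro mult_right_mono) auto
    thus ?thesis using c by (simp add: \<delta>_def)
  qed
  show thesis
  proof (rule that[OF \<delta>])
    fix d :: "real \<Rightarrow> real" assume d: "\<And>s. s \<in> D \<Longrightarrow> 0 \<le> d s \<and> d s \<le> \<delta>"
    define g where "g t = (\<Sum>s\<in>D. d s * h s t)" for t
    have g0: "g t \<ge> 0" for t unfolding g_def using d h(1) by (intro sum_nonneg) auto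
    have g1: "g t \<le> min r e / 2" for t
    proof -
      have "g t \<le> (\<Sum>s\<in>D. \<delta> * 1)" unfolding g_def
        using d h(1,2) \<delta> by (intro sum_mono mult_mono) auto
      thus ?thesis using \<delta>c by (simp)
    qed
    have lip: "\<bar>g t - g u\<bar> \<le> \<bar>t - u\<bar> / 2" for t u
    proof -
      have "\<bar>g t - g u\<bar> = \<bar>\<Sum>s\<in>D. d s * (h s t - h s u)\<bar>"
        by (simp add: g_def sum_subtractf right_diff_distrib)
      also have "\<dots> \<le> (\<Sum>s\<in>D. \<delta> * (\<bar>t - u\<bar> / r))"
        using d h(3) \<delta> r(1) by (intro order_trans[OF sum_abs] sum_mono)
          (simp only: abs_mult, intro mult_mono, auto)
      also have "\<dots> = (real (card D) * \<delta>) * (\<bar>t - u\<bar> / r)" by simp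
      also have "\<dots> \<le> (r / 2) * (\<bar>t - u\<bar> / r)"
        using \<delta>c r(1) by (intro mult_right_mono) auto
      finally show ?thesis using r(1) by simp
    qed
    define \<tau> where "\<tau> t = t + g t" for t
    have cont: "continuous_on {0..} \<tau>"
      unfolding \<tau>_def g_def h_def using r(1) by (intro continuous_intros) auto
    have mono: "strict_mono_on {0..} \<tau>"
    proof (rule strict_mono_onI)
      fix t u :: real assume "t < u"
      thus "\<tau> t < \<tau> u" using lip[of t u] unfolding \<tau>_def abs_le_iff abs_if
        by (auto split: if_splits)
    qed
    have \<tau>0: "\<tau> 0 = 0" 
    proof -
      have "h s 0 = 0" if "s \<in> D" for s using h_other[of 0 s] r(2)[OF that] by simp
      thus ?thesis by (simp add: \<tau>_def g_def)
    qed
    have img: "\<tau> ` {0..} = {0..}"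
    proof
      show "\<tau> ` {0..} \<subseteq> {0..}" using g0 by (auto simp: \<tau>_def add_nonneg_nonneg)
      show "{0..} \<subseteq> \<tau> ` {0..}"
      proof
        fix y :: real assume y: "y \<in> {0..}"
        have "\<exists>x\<ge>0. x \<le> y \<and> \<tau> x = y"
        proof (rule IVT')
          show "\<tau> 0 \<le> y" "y \<le> \<tau> y" "0 \<le> y" using \<tau>0 y g0 by (auto simp: \<tau>_def)
          show "continuous_on {0..y} \<tau>" by (rule continuous_on_subset[OF cont]) auto
        qed
        thus "y \<in> \<tau> ` {0..}" by force
      qed
    qed
    have "\<tau> s = s + d s" if s: "s \<in> D" for s
    proof -
      have "g s = (\<Sum>s'\<in>D. if s' = s then d s else 0)" unfolding g_def
        using r s by (intro sum.cong) (auto simp: h_other h_def[of s s])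
      thus ?thesis using D(1) s by (simp add: \<tau>_def)
    qed
    moreover have "\<bar>\<tau> t - t\<bar> < e" for t
      using g0[of t] g1[of t] e by (simp add: \<tau>_def)
    ultimately show "\<exists>\<tau>\<in>time_changes. (\<forall>t\<ge>0. \<bar>\<tau> t - t\<bar> < e) \<and> (\<forall>s\<in>D. \<tau> s = s + d s)"
      using cont mono img by (intro bexI[of _ \<tau>]) (auto simp: time_changes_def)
  qed
qed

text \<open>
  Lower bounds of the Rayleigh path are characterised without the infimum. On a configuration in the
  positive quadrant the extended real in the definition lies between \<open>0\<close> and \<open>t\<close>, so that taking its
  real part loses nothing.
\<close>

lemma le_rayleigh_iff:
  assumes S: "S \<subseteq> {0..} \<times> {0..}" and t: "t \<ge> 0"
  shows "c \<le> rayleigh S t \<longleftrightarrow> c \<le> t \<and> (\<forall>(s, x)\<in>S. s \<le> t \<longrightarrow> c \<le> x + (t - s))"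
proof -
  define I where "I = (INF (s, x) \<in> {(s, x). (s, x) \<in> S \<and> s \<le> t}. ereal (x + (t - s)))"
  have I: "ereal c \<le> I \<longleftrightarrow> (\<forall>(s, x)\<in>S. s \<le> t \<longrightarrow> c \<le> x + (t - s))" for c
    unfolding I_def by (auto simp: le_INF_iff)
  have "ereal 0 \<le> I" unfolding I using S by force
  hence "min (ereal t) I \<noteq> - \<infinity>" using t by (auto simp: min_def)
  moreover have "min (ereal t) I \<noteq> \<infinity>" by (auto simp: min_def)
  ultimately obtain z where z: "min (ereal t) I = ereal z" by (cases "min (ereal t) I") auto
  have "c \<le> rayleigh S t \<longleftrightarrow> ereal c \<le> min (ereal t) I"
    unfolding rayleigh_def I_def[symmetric] z by simp
  thus ?thesis using I by simp
qed

lemma rayleigh_le: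
  assumes "S \<subseteq> {0..} \<times> {0..}" "t \<ge> 0"
  shows "rayleigh S t \<le> t" "\<And>s x. (s, x) \<in> S \<Longrightarrow> s \<le> t \<Longrightarrow> rayleigh S t \<le> x + (t - s)"
  using le_rayleigh_iff[OF assms, of "rayleigh S t"] by auto

text \<open>
  A point with \<open>s \<le> x\<close> never brings the path below the line of slope one through the origin. Between
  the abscissae of the other points the path therefore has slope one.
\<close>

lemma rayleigh_slope:
  assumes S: "S \<subseteq> {0..} \<times> {0..}" and t: "0 \<le> t" "t \<le> u"
    and no: "\<And>s x. (s, x) \<in> S \<Longrightarrow> t < s \<Longrightarrow> s \<le> u \<Longrightarrow> s \<le> x"
  shows "rayleigh S u = rayleigh S t + (u - t)"
proof -
  have "c \<le> rayleigh S u \<longleftrightarrow> c \<le> rayleigh S t + (u - t)" for c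
  proof
    assume c: "c \<le> rayleigh S u"
    have "c - (u - t) \<le> rayleigh S t"
      unfolding le_rayleigh_iff[OF S t(1)]
      using c[unfolded le_rayleigh_iff[OF S order_trans[OF t]]] t(2) by force
    thus "c \<le> rayleigh S t + (u - t)" by simp
  next
    assume "c \<le> rayleigh S t + (u - t)"
    hence c: "c - (u - t) \<le> rayleigh S t" by simp
    have "c \<le> x + (u - s)" if "(s, x) \<in> S" "s \<le> u" for s x
    proof (cases "s \<le> t")
      case True
      thus ?thesis using c[unfolded le_rayleigh_iff[OF S t(1)]] that(1) by force
    next
      case False
      hence "s \<le> x" using no that by force
      thus ?thesis using c[unfolded le_rayleigh_iff[OF S t(1)]] by simp
    qed
    thus "c \<le> rayleigh S u"
      unfolding le_rayleigh_iff[OF S order_trans[OF t]]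
      using c[unfolded le_rayleigh_iff[OF S t(1)]] by auto
  qed
  thus ?thesis by (meson dual_order.refl order_antisym)
qed

text \<open>
  Only these times can be downward jumps of the Rayleigh path on \<open>[0, T]\<close>. The time \<open>0\<close> is left out,
  because a time change cannot move it; a point with abscissa \<open>0\<close> has no effect on the path.
\<close>

definition corner_points :: "(real \<times> real) set \<Rightarrow> real \<Rightarrow> real set" where
  "corner_points S T = {s. 0 < s \<and> (\<exists>x. (s, x) \<in> S \<and> s \<le> T \<and> x \<le> T)}"

lemma finite_corner_points:
  assumes S: "S \<subseteq> {0..} \<times> {0..}" and fin: "\<And>B. bounded B \<Longrightarrow> finite (S \<inter> B)"
  shows "finite (corner_points S T)"
proof -
  have "corner_points S T \<subseteq> fst ` (S \<inter> ({0..T} \<times> {0..T}))"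
    using S by (force simp: corner_points_def)
  thus ?thesis using fin[of "{0..T} \<times> {0..T}"] finite_subset
    by (blast intro: bounded_Times bounded_closed_interval)
qed

lemma rayleigh_cadlag:
  assumes S: "S \<subseteq> {0..} \<times> {0..}" and fin: "\<And>B. bounded B \<Longrightarrow> finite (S \<inter> B)"
  shows "(\<lambda>t\<in>{0..}. rayleigh S t) \<in> cadlag_paths"
proof -
  let ?f = "\<lambda>t\<in>{0..}. rayleigh S t"
  have r: "(?f \<longlongrightarrow> ?f t) (at_right t)" if t: "t \<ge> 0" for t
  proof -
    have "open (- (corner_points S (t + 1) - {t}))"
      using finite_corner_points[OF S fin] by (intro open_Compl finite_imp_closed) auto
    moreover have "t \<in> - (corner_points S (t + 1) - {t})" by simp
    ultimately obtain d where d: "d > 0" "\<And>u. dist u t < d \<Longrightarrow> u \<notin> corner_points S (t + 1) - {t}"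
      unfolding open_dist by blast
    have "?f u = rayleigh S t + (u - t)" if u: "u > t" "u < t + min d 1" for u
    proof -
      have "rayleigh S u = rayleigh S t + (u - t)"
      proof (rule rayleigh_slope[OF S t])
        fix s x assume s: "(s, x) \<in> S" "t < s" "s \<le> u"
        hence "s \<notin> corner_points S (t + 1)" using d(2)[of s] u by (auto simp: dist_real_def)
        thus "s \<le> x" using s u t by (force simp: corner_points_def)
      qed (use u in simp)
      thus ?thesis using u t by simp
    qed
    hence "\<forall>\<^sub>F u in at_right t. rayleigh S t + (u - t) = ?f u"
      unfolding eventually_at_right_field using d(1) by (intro exI[of _ "t + min d 1"]) auto
    moreover have "((\<lambda>u. rayleigh S t + (u - t)) \<longlongrightarrow> rayleigh S t + (t - t)) (at_right t)"
      by (intro tendsto_intros)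
    ultimately show ?thesis using t by (auto intro: Lim_transform_eventually)
  qed
  have l: "\<exists>l. (?f \<longlongrightarrow> l) (at_left t)" if t: "t > 0" for t
  proof -
    have "open (- (corner_points S t - {t}))"
      using finite_corner_points[OF S fin] by (intro open_Compl finite_imp_closed) auto
    moreover have "t \<in> - (corner_points S t - {t})" by simp
    ultimately obtain d where d: "d > 0" "\<And>u. dist u t < d \<Longrightarrow> u \<notin> corner_points S t - {t}"
      unfolding open_dist by blast
    define t0 where "t0 = t - min (d / 2) t"
    have t0: "0 \<le> t0" "t0 < t" "t - t0 < d" using d(1) t by (auto simp: t0_def)
    have "?f u = rayleigh S t0 + (u - t0)" if u: "u > t0" "u < t" for u
    proof -
      have "rayleigh S u = rayleigh S t0 + (u - t0)"
      proof (rule rayleigh_slope[OF S t0(1)])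
        fix s x assume s: "(s, x) \<in> S" "t0 < s" "s \<le> u"
        hence "s \<notin> corner_points S t" using d(2)[of s] u t0 by (auto simp: dist_real_def)
        thus "s \<le> x" using s u t0 by (force simp: corner_points_def)
      qed (use u in simp)
      thus ?thesis using u t0 by simp
    qed
    hence "\<forall>\<^sub>F u in at_left t. rayleigh S t0 + (u - t0) = ?f u"
      unfolding eventually_at_left_field using t0 by (intro exI[of _ t0]) auto
    moreover have "((\<lambda>u. rayleigh S t0 + (u - t0)) \<longlongrightarrow> rayleigh S t0 + (t - t0)) (at_left t)"
      by (intro tendsto_intros)
    ultimately show ?thesis by (blast intro: Lim_transform_eventually)
  qed
  show ?thesis using r l by (auto simp: cadlag_paths_def)
qed

section \<open>Pathwise convergence of the rescaled chain\<close>

primrec min_chain :: "(nat \<Rightarrow> nat) \<Rightarrow> nat \<Rightarrow> nat" where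
  "min_chain u 0 = 1"
| "min_chain u (Suc m) = min (Suc (min_chain u m)) (u m)"

text \<open>
  The discrete counterpart of \<open>le_rayleigh_iff\<close>. The value \<open>u i\<close> enters at time \<open>i + 1\<close>, whence the
  offset in \<open>m - 1 - i\<close>.
\<close>

lemma le_min_chain_iff:
  fixes c :: real
  shows "c \<le> real (min_chain u m) \<longleftrightarrow>
    c \<le> real m + 1 \<and> (\<forall>i<m. c \<le> real (u i) + (real m - 1 - real i))"
proof (induction m arbitrary: c)
  case (Suc m)
  have "c \<le> real (min_chain u (Suc m)) \<longleftrightarrow> c - 1 \<le> real (min_chain u m) \<and> c \<le> real (u m)"
    by (auto simp: min_def)
  also have "\<dots> \<longleftrightarrow> c \<le> real (Suc m) + 1 \<and> (\<forall>i<Suc m. c \<le> real (u i) + (real (Suc m) - 1 - real i))"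
    unfolding Suc by (auto simp: less_Suc_eq algebra_simps)
  finally show ?case .
qed simp

lemma min_chain_le:
  "real (min_chain u m) \<le> real m + 1"
  "i < m \<Longrightarrow> real (min_chain u m) \<le> real (u i) + (real m - 1 - real i)"
  using le_min_chain_iff[of "real (min_chain u m)" u m] by auto

definition time_strip :: "(real \<times> real) set \<Rightarrow> real \<Rightarrow> nat \<Rightarrow> (real \<times> real) set" where
  "time_strip S a i = {(s, x) \<in> S. real i \<le> s * a \<and> s * a < real i + 1}"

text \<open>
  The assumptions say that \<open>u n i\<close> is asymptotically \<open>a n\<close> times the height of the lowest point in the
  \<open>i\<close>-th strip. The lower bound is uniform over heights up to \<open>Y\<close>, as the height required of a strip
  varies with the time at which the paths are compared; it also forces \<open>u n i\<close> to be large on strips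
  without low points. Lower bounds characterise both paths (\<open>le_rayleigh_iff\<close>, \<open>le_min_chain_iff\<close>), so
  the comparison goes strip by strip, and several points may share a strip.
\<close>

lemma scaled_min_chain_tendsto_rayleigh:
  assumes S: "S \<subseteq> {0..} \<times> {0..}" and fin: "\<And>B. bounded B \<Longrightarrow> finite (S \<inter> B)"
    and a: "filterlim a at_top sequentially" "\<And>n. a n \<ge> 0"
    and upper: "\<And>n i s x. n \<ge> 1 \<Longrightarrow> (s, x) \<in> time_strip S (a n) i \<Longrightarrow> real (u n i) \<le> x * a n + 1"
    and lower: "\<And>Y e. e > 0 \<Longrightarrow> \<forall>\<^sub>F n in sequentially. \<forall>i y. y \<le> Y \<longrightarrow>
        (\<forall>(s, x)\<in>time_strip S (a n) i. y \<le> x) \<longrightarrow> (y - e) * a n \<le> real (u n i)"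
  shows "limitin skorokhod_J1 (\<lambda>n. scaled_path (a n) (min_chain (u n)))
           (\<lambda>t\<in>{0..}. rayleigh S t) sequentially"
proof (rule limitin_skorokhod_J1I[OF rayleigh_cadlag[OF S fin]])
  fix T' \<epsilon> :: real assume \<epsilon>: "\<epsilon> > 0"
  define T where "T = max T' 0"
  \<comment> \<open>The errors below add up to \<open>4 * e\<close>.\<close>
  define e where "e = min 1 (\<epsilon> / 5)"
  have e: "e > 0" "e \<le> 1" "5 * e \<le> \<epsilon>" using \<epsilon> by (auto simp: e_def)
  let ?D = "corner_points S (T + 1)"
  obtain \<delta> where \<delta>: "\<delta> > 0"
    "\<And>d. (\<And>s. s \<in> ?D \<Longrightarrow> 0 \<le> d s \<and> d s \<le> \<delta>) \<Longrightarrow>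
       \<exists>\<tau>\<in>time_changes. (\<forall>t\<ge>0. \<bar>\<tau> t - t\<bar> < e) \<and> (\<forall>s\<in>?D. \<tau> s = s + d s)"
    by (rule time_change_shifting[OF finite_corner_points[OF S fin] _ e(1), of "T + 1"])
      (auto simp: corner_points_def)
  \<comment> \<open>Shifts to the right end of a strip are at most \<open>1 / a n\<close>, which has to be admissible for the
     time change and negligible against \<open>e\<close>.\<close>
  have "\<forall>\<^sub>F n in sequentially. 1 / \<delta> + 1 / e \<le> a n"
    using a(1) unfolding filterlim_at_top by blast
  with lower[OF e(1), of "T + 1"] eventually_ge_at_top[of 1]
  show "\<forall>\<^sub>F n in sequentially.
      scaled_path (a n) (min_chain (u n)) \<in> J1_nhd (\<lambda>t\<in>{0..}. rayleigh S t) T' \<epsilon>"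
  proof eventually_elim
    case (elim n)
    define A where "A = a n"
    have A: "A > 0" "1 / A \<le> \<delta>" "1 / A \<le> e"
    proof -
      have p: "1 / \<delta> > 0" "1 / e > 0" using \<delta>(1) e(1) by auto
      have q: "1 / \<delta> \<le> A" "1 / e \<le> A" using elim(3) p unfolding A_def by linarith+
      show "A > 0" using p q by linarith
      thus "1 / A \<le> \<delta>" "1 / A \<le> e" using q \<delta>(1) e(1) by (auto simp: field_simps)
    qed
    define d where "d s = (of_int \<lfloor>s * A\<rfloor> + 1) / A - s" for s
    have "0 \<le> d s \<and> d s \<le> \<delta>" for s
    proof -
      have d: "d s = (of_int \<lfloor>s * A\<rfloor> + 1 - s * A) / A" using A(1) by (simp add: d_def field_simps)
      have "0 \<le> d s" unfolding d using A(1) by (intro divide_nonneg_pos) linarith+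
      moreover have "d s \<le> 1 / A" unfolding d using A(1) by (intro divide_right_mono) linarith+
      ultimately show ?thesis using A(2) by linarith
    qed
    then obtain \<tau> where \<tau>: "\<tau> \<in> time_changes" "\<And>t. t \<ge> 0 \<Longrightarrow> \<bar>\<tau> t - t\<bar> < e"
      "\<And>s. s \<in> ?D \<Longrightarrow> \<tau> s = s + d s"
      using \<delta>(2)[of d] by blast
    have mono: "\<tau> s \<le> \<tau> t \<longleftrightarrow> s \<le> t" if "s \<ge> 0" "t \<ge> 0" for s t
      using \<tau>(1) that by (intro strict_mono_on_less_eq[of "{0..}"]) (auto simp: time_changes_def)
    have "\<bar>scaled_path A (min_chain (u n)) (\<tau> t) - rayleigh S t\<bar> < \<epsilon>" if t: "0 \<le> t" "t \<le> T" for t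
    proof -
      define m where "m = nat \<lfloor>\<tau> t * A\<rfloor>"
      define R where "R = rayleigh S t"
      have R: "R \<le> t" "\<And>s x. (s, x) \<in> S \<Longrightarrow> s \<le> t \<Longrightarrow> R \<le> x + (t - s)"
        using rayleigh_le[OF S t(1)] by (auto simp: R_def)
      have \<tau>t: "\<tau> t \<ge> 0" "\<tau> t < t + e" "\<tau> t > t - e"
        using time_change_nonneg[OF \<tau>(1) t(1)] \<tau>(2)[OF t(1)] by auto
      have m: "real m \<le> \<tau> t * A" "\<tau> t * A < real m + 1"
        using \<tau>t(1) A(1) by (auto simp: m_def)
      have i_le: "i < m \<longleftrightarrow> real i + 1 \<le> \<tau> t * A" for i
        using m by linarith
      have eA: "1 \<le> e * A" using A by (simp add: field_simps)
      have \<tau>A: "(t - e) * A \<le> \<tau> t * A" "\<tau> t * A \<le> (t + e) * A"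
        using \<tau>t A(1) by auto
      \<comment> \<open>\<open>\<tau>\<close> moves a corner \<open>s\<close> to the right end of its strip, the first time at which the
         chain has used that strip\<close>
      have col: "\<tau> s * A = real i + 1" if "(s, x) \<in> time_strip S A i" "s \<in> ?D" for s x i
      proof -
        have "\<lfloor>s * A\<rfloor> = int i" using that(1) by (auto simp: time_strip_def floor_eq_iff)
        thus ?thesis using \<tau>(3)[OF that(2)] A(1) by (simp add: d_def)
      qed
      have lo: "(R - 4 * e) * A \<le> real (min_chain (u n) m)"
        unfolding le_min_chain_iff
      proof (intro conjI allI impI)
        have "R * A \<le> t * A" using R(1) A(1) by simp
        thus "(R - 4 * e) * A \<le> real m + 1" using m(2) \<tau>A eA by (simp add: algebra_simps)
        fix i assume i: "i < m"
        have iA: "real i / A \<le> T + 1"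
        proof -
          have "real i \<le> (t + e) * A" using i i_le[of i] \<tau>A by linarith
          hence "real i / A \<le> t + e" using A(1) by (simp add: field_simps)
          thus ?thesis using t e by linarith
        qed
        \<comment> \<open>The height that every point of strip \<open>i\<close> must have, given that the Rayleigh path is at \<open>R\<close>
           at time \<open>t\<close>.\<close>
        define y where "y = R - t + real i / A"
        have y: "y \<le> T + 1" using iA R(1) by (simp add: y_def)
        have "y \<le> x" if sx: "(s, x) \<in> time_strip S A i" for s x
        proof (cases "s \<le> t")
          case True
          have "real i / A \<le> s" using sx A(1) by (auto simp: time_strip_def field_simps)
          thus ?thesis using R(2)[of s x] True sx by (auto simp: time_strip_def y_def)
        next
          case False
          \<comment> \<open>A corner in a strip that the chain has used by time \<open>\<tau> t\<close> lies at or before \<open>t\<close>, so \<open>s\<close> is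
             not a corner and \<open>x\<close> is beyond the range of heights considered.\<close>
          have "s \<notin> ?D"
          proof
            assume D: "s \<in> ?D"
            have "\<tau> s * A \<le> \<tau> t * A" using col[OF sx D] i i_le by simp
            hence "s \<le> t" using mono[of s t] D t A(1) by (auto simp: corner_points_def)
            thus False using False by simp
          qed
          moreover have "s \<le> T + 1"
          proof -
            have "s * A < real i + 1" using sx by (auto simp: time_strip_def)
            also have "\<dots> \<le> (t + e) * A" using i i_le[of i] \<tau>A by linarith
            finally have "s < t + e" using A(1) by simp
            thus ?thesis using t e by linarith
          qed
          ultimately have "x > T + 1" using sx False t by (force simp: corner_points_def time_strip_def)
          thus ?thesis using y by simp
        qed
        hence "(y - e) * A \<le> real (u n i)" using elim(1) y unfolding A_def by blast
        moreover have "(y - e) * A = (R - t - e) * A + real i"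
          using A(1) by (simp add: y_def algebra_simps)
        ultimately show "(R - 4 * e) * A \<le> real (u n i) + (real m - 1 - real i)"
          using m(2) \<tau>A eA by (simp add: algebra_simps)
      qed
      define z where "z = real (min_chain (u n) m) / A - 4 * e"
      have zA: "(z + 4 * e) * A = real (min_chain (u n) m)" using A(1) by (simp add: z_def)
      have hi: "z \<le> R"
      proof -
        have "(z + 4 * e) * A \<le> real m + 1" unfolding zA by (rule min_chain_le)
        hence "(z + 4 * e) * A \<le> (t + 2 * e) * A" using m(1) \<tau>A eA by (simp add: algebra_simps)
        hence zt: "z + 2 * e \<le> t" using A(1) by simp
        have "z \<le> x + (t - s)" if sx: "(s, x) \<in> S" "s \<le> t" for s x
        proof (cases "s \<le> x")
          case True thus ?thesis using zt e(1) by linarith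
        next
          case False
          have nn: "s \<ge> 0" "x \<ge> 0" using S sx by auto
          have D: "s \<in> ?D" using False sx t nn by (auto simp: corner_points_def intro!: exI[of _ x])
          define i where "i = nat \<lfloor>s * A\<rfloor>"
          have sc: "(s, x) \<in> time_strip S A i" using sx nn A(1) by (auto simp: time_strip_def i_def)
          have "\<tau> s * A \<le> \<tau> t * A" using mono[of s t] sx nn t A(1) by simp
          hence i: "i < m" using i_le col[OF sc D] by simp
          have "(z + 4 * e) * A \<le> real (u n i) + (real m - 1 - real i)"
            unfolding zA by (rule min_chain_le(2)[OF i])
          moreover have "real (u n i) \<le> x * A + 1" using upper[OF elim(2)] sc unfolding A_def by blast
          moreover have "s * A < real i + 1" using sc by (auto simp: time_strip_def)
          ultimately have "(z + 4 * e) * A \<le> (x + (t - s) + 2 * e) * A"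
            using m(1) \<tau>A eA by (simp add: algebra_simps)
          thus ?thesis using A(1) e(1) by simp
        qed
        thus ?thesis unfolding R_def le_rayleigh_iff[OF S t(1)] using zt e(1) by auto
      qed
      have "R - 4 * e \<le> real (min_chain (u n) m) / A" using lo A(1) by (simp add: pos_le_divide_eq)
      hence "\<bar>real (min_chain (u n) m) / A - R\<bar> < \<epsilon>" using hi e unfolding z_def by linarith
      moreover have "scaled_path A (min_chain (u n)) (\<tau> t) = real (min_chain (u n) m) / A"
        using \<tau>t(1) by (simp add: scaled_path_def m_def divide_inverse mult.commute)
      ultimately show ?thesis by (simp add: R_def)
    qed
    moreover have "\<And>t. t \<ge> 0 \<Longrightarrow> \<bar>\<tau> t - t\<bar> < \<epsilon>" using \<tau>(2) e by force
    ultimately show ?case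
      unfolding J1_nhd_def A_def[symmetric] using scaled_path_cadlag[of A] A(1) \<tau>(1)
      by (auto intro!: bexI[of _ \<tau>] simp: T_def)
  qed
qed

section \<open>The chain driven by independent ranks\<close>

lemma min_chain_cong: "(\<And>i. i < m \<Longrightarrow> u i = v i) \<Longrightarrow> min_chain u m = min_chain v m"
  by (induction m) auto

lemma measurable_min_chain:
  assumes U: "\<And>i. i < m \<Longrightarrow> U i \<in> M \<rightarrow>\<^sub>M count_space UNIV"
  shows "(\<lambda>\<omega>. min_chain (\<lambda>i. U i \<omega>) m) \<in> M \<rightarrow>\<^sub>M count_space UNIV"
  using U
proof (induction m)
  case (Suc m)
  have "(\<lambda>\<omega>. (\<lambda>p. min (Suc (fst p)) (snd p)) (min_chain (\<lambda>i. U i \<omega>) m, U m \<omega>)) \<in> M \<rightarrow>\<^sub>M count_space UNIV"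
    by (rule measurable_compose[OF measurable_Pair[OF Suc.IH Suc.prems]])
       (simp_all add: pair_measure_countable Suc.prems)
  thus ?case by simp
qed simp

text \<open>
  The first \<open>m + 1\<close> values of the chain are a function of the first \<open>m\<close> ranks, hence independent of
  the rank that drives the next step.
\<close>

lemma min_chain_Suc_law:
  assumes N: "prob_space N"
    and indep: "prob_space.indep_vars N (\<lambda>_. count_space UNIV) U {..<Suc m}"
    and law: "\<And>b. measure N {\<omega> \<in> space N. U m \<omega> = b} = pmf q b"
    and zs: "length zs = Suc m"
  shows "measure N {\<omega> \<in> space N. map (min_chain (\<lambda>i. U i \<omega>)) [0..<Suc (Suc m)] = zs @ [b]} =
     measure N {\<omega> \<in> space N. map (min_chain (\<lambda>i. U i \<omega>)) [0..<Suc m] = zs} *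
       pmf (map_pmf (min (Suc (last zs))) q) b"
proof -
  interpret prob_space N by fact
  have U: "U i \<in> N \<rightarrow>\<^sub>M count_space UNIV" if "i < Suc m" for i
    using indep that by (auto simp: indep_vars_def)
  let ?Q = "\<lambda>J. PiM J (\<lambda>_. count_space (UNIV :: nat set))"
  define past where "past f = map (min_chain f) [0..<Suc m]" for f
  define Xa where "Xa = {f \<in> space (?Q {..<m}). past f = zs}"
  define Xb where "Xb = {f \<in> space (?Q {m}). min (Suc (last zs)) (f m) = b}"
  have "(\<lambda>f. map (\<lambda>i. min_chain f i) [0..<l]) \<in> ?Q {..<m} \<rightarrow>\<^sub>M count_space UNIV" if "l \<le> Suc m" for l
    using that
  proof (induction l)
    case (Suc l)
    have "(\<lambda>f. min_chain (\<lambda>i. f i) l) \<in> ?Q {..<m} \<rightarrow>\<^sub>M count_space UNIV"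
      using Suc.prems by (intro measurable_min_chain measurable_component_singleton) auto
    hence "(\<lambda>f. (\<lambda>p. fst p @ [snd p]) (map (\<lambda>i. min_chain f i) [0..<l], min_chain f l)) \<in>
        ?Q {..<m} \<rightarrow>\<^sub>M count_space UNIV"
      using Suc by (intro measurable_compose[OF measurable_Pair]) (auto simp: pair_measure_countable)
    thus ?case by simp
  qed simp
  hence "past \<in> ?Q {..<m} \<rightarrow>\<^sub>M count_space UNIV" by (simp add: past_def[abs_def] del: upt_Suc)
  hence Xa: "Xa \<in> sets (?Q {..<m})"
    using measurable_sets[of past _ "count_space UNIV" "{zs}"]
    by (simp add: Xa_def vimage_def Int_def conj_commute)
  have "(\<lambda>f. min (Suc (last zs)) (f m)) \<in> ?Q {m} \<rightarrow>\<^sub>M count_space UNIV"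
    by (rule measurable_compose[OF measurable_component_singleton]) auto
  hence Xb: "Xb \<in> sets (?Q {m})"
    using measurable_sets[of _ _ "count_space UNIV" "{b}"]
    by (fastforce simp: Xb_def vimage_def Int_def conj_commute)
  have past: "past (restrict (\<lambda>i. U i \<omega>) {..<m}) = map (min_chain (\<lambda>i. U i \<omega>)) [0..<Suc m]" for \<omega>
    unfolding past_def by (intro map_cong min_chain_cong) auto
  have "map (min_chain (\<lambda>i. U i \<omega>)) [0..<Suc (Suc m)] = zs @ [b] \<longleftrightarrow>
      map (min_chain (\<lambda>i. U i \<omega>)) [0..<Suc m] = zs \<and> min (Suc (last zs)) (U m \<omega>) = b" for \<omega>
    by (auto simp: last_conv_nth)
  hence e1: "{\<omega> \<in> space N. map (min_chain (\<lambda>i. U i \<omega>)) [0..<Suc (Suc m)] = zs @ [b]} =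
      (\<lambda>\<omega>. (restrict (\<lambda>i. U i \<omega>) {..<m}, restrict (\<lambda>i. U i \<omega>) {m})) -` (Xa \<times> Xb) \<inter> space N"
    unfolding Xa_def Xb_def by (auto simp: past space_PiM simp del: upt_Suc)
  have e2: "measure N ((\<lambda>\<omega>. (restrict (\<lambda>i. U i \<omega>) {..<m}, restrict (\<lambda>i. U i \<omega>) {m})) -` (Xa \<times> Xb) \<inter> space N)
      = measure N ((\<lambda>\<omega>. restrict (\<lambda>i. U i \<omega>) {..<m}) -` Xa \<inter> space N) *
        measure N ((\<lambda>\<omega>. restrict (\<lambda>i. U i \<omega>) {m}) -` Xb \<inter> space N)"
    by (rule indep_varD[OF indep_var_restrict[OF indep] Xa Xb]) auto
  have e3: "(\<lambda>\<omega>. restrict (\<lambda>i. U i \<omega>) {..<m}) -` Xa \<inter> space N =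
      {\<omega> \<in> space N. map (min_chain (\<lambda>i. U i \<omega>)) [0..<Suc m] = zs}"
    unfolding Xa_def by (auto simp: past space_PiM simp del: upt_Suc)
  have e4: "measure N ((\<lambda>\<omega>. restrict (\<lambda>i. U i \<omega>) {m}) -` Xb \<inter> space N) =
      pmf (map_pmf (min (Suc (last zs))) q) b"
  proof -
    let ?A = "{u. min (Suc (last zs)) u = b}"
    have "distr N (count_space UNIV) (U m) = measure_pmf q"
    proof (rule measure_eqI_countable[where A = UNIV])
      show "emeasure (distr N (count_space UNIV) (U m)) {u} = emeasure (measure_pmf q) {u}" for u
        using law[of u] U[of m]
        by (simp add: emeasure_distr emeasure_pmf_single emeasure_eq_measure vimage_def Int_def conj_commute)
    qed auto
    hence "measure (measure_pmf q) ?A = measure N (U m -` ?A \<inter> space N)"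
      using measure_distr[OF U[of m], of ?A] by simp
    moreover have "(\<lambda>\<omega>. restrict (\<lambda>i. U i \<omega>) {m}) -` Xb \<inter> space N = U m -` ?A \<inter> space N"
      unfolding Xb_def by (auto simp: space_PiM)
    ultimately show ?thesis by (simp add: pmf.rep_eq vimage_def)
  qed
  show ?thesis unfolding e1 e2 e3 e4 ..
qed

lemma le_length_0: "le_length X 0 \<omega> = 1"
proof -
  have "{t. t < Suc 0 \<and> [X 0 \<omega>] ! t = X 0 \<omega>} = {0}" by auto
  hence "le_count [X 0 \<omega>] = 1" by (intro le_count_eqI) auto
  thus ?thesis by (simp add: le_length_def length_loop_erasure)
qed

text \<open>
  Both chains start at \<open>1\<close> and have the same transition probabilities.
\<close>

lemma le_length_law_eq_min_chain:
  assumes k: "k \<ge> 1" and n: "n \<ge> 1" and walk: "maximal_choice_walk k n M X"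
    and N: "prob_space N"
    and indep: "\<And>m. prob_space.indep_vars N (\<lambda>_. count_space UNIV) U {..<Suc m}"
    and law: "\<And>m b. measure N {\<omega> \<in> space N. U m \<omega> = b} = pmf (top_rank_pmf k n) b"
  shows "measure M {\<omega> \<in> space M. map (\<lambda>i. le_length X i \<omega>) [0..<Suc m] = zs} =
    measure N {\<omega> \<in> space N. map (min_chain (\<lambda>i. U i \<omega>)) [0..<Suc m] = zs}"
proof (induction m arbitrary: zs)
  case 0
  interpret M: prob_space M using walk by (simp add: maximal_choice_walk_def)
  interpret N: prob_space N by fact
  show ?case by (cases "zs = [1]") (auto simp: le_length_0 M.prob_space N.prob_space)
next
  case (Suc m)
  show ?case
  proof (cases "length zs = Suc (Suc m)")
    case True
    then obtain ys b where zs: "zs = ys @ [b]" "length ys = Suc m"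
      by (cases zs rule: rev_cases) auto
    show ?thesis unfolding zs(1) le_length_Suc_law[OF k n walk zs(2)]
      min_chain_Suc_law[OF N indep law zs(2)] Suc ..
  next
    case False
    have e: "(map f [0..<Suc (Suc m)] = zs) = False" for f :: "nat \<Rightarrow> nat" using False by auto
    show ?thesis unfolding e by simp
  qed
qed

section \<open>Ranks read off the Poisson process\<close>

definition time_scale :: "nat \<Rightarrow> nat \<Rightarrow> real" where
  "time_scale k n = real n powr (real k / (real k + 1))"

text \<open>
  The height \<open>h\<close> with \<open>1 - exp (- h ^ k / a) = (j / n) ^ k\<close> for the time scale \<open>a\<close>: the lowest point of
  a strip of width \<open>1 / a\<close> is at most this high with the probability that the top rank is at most \<open>j\<close>.
\<close>

definition rank_height :: "nat \<Rightarrow> nat \<Rightarrow> nat \<Rightarrow> real" where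
  "rank_height k n j = root k (- (time_scale k n * ln (1 - (real j / real n) ^ k)))"

text \<open>
  The quantile transform of the height of the lowest point in the strip. No finite height corresponds
  to the rank \<open>n\<close>, which is reached when the strip has no point up to the height of rank \<open>n - 1\<close>.
\<close>

definition strip_rank :: "nat \<Rightarrow> nat \<Rightarrow> (real \<times> real) set \<Rightarrow> nat \<Rightarrow> nat" where
  "strip_rank k n S i =
     (LEAST j. n \<le> j \<or> (\<exists>(s, x) \<in> time_strip S (time_scale k n) i. x \<le> rank_height k n j))"

lemma time_scale_pos: "n \<ge> 1 \<Longrightarrow> time_scale k n > 0"
  by (simp add: time_scale_def)

lemma time_scale_nonneg: "time_scale k n \<ge> 0"
  by (simp add: time_scale_def)

text \<open>
  This is where the exponent comes from: \<open>a ^ (k + 1) = n ^ k\<close>.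
\<close>

lemma time_scale_power:
  assumes n: "n \<ge> 1"
  shows "time_scale k n * (real j / real n) ^ k = (real j / time_scale k n) ^ k"
proof -
  let ?a = "time_scale k n"
  have "?a ^ Suc k = ?a powr real (Suc k)" 
    by (rule powr_realpow[OF time_scale_pos[OF n], symmetric])
  also have "\<dots> = real n powr ((real k / (real k + 1)) * (real k + 1))"
    by (simp add: time_scale_def powr_powr add.commute del: times_divide_eq_left)
  also have "(real k / (real k + 1)) * (real k + 1) = real k" by simp
  also have "real n powr real k = real n ^ k" using n by (simp add: powr_realpow)
  finally have "?a * ?a ^ k = real n ^ k" by simp
  thus ?thesis using time_scale_pos[OF n, of k] n by (simp add: power_divide field_simps)
qed

lemma rank_power_less_1:
  assumes "k \<ge> 1" "j < n"
  shows "0 \<le> (real j / real n) ^ k" "(real j / real n) ^ k < 1"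
  using assms by (auto simp: power_less_one_iff)

lemma rank_height_power:
  assumes "k \<ge> 1" "j < n"
  shows "rank_height k n j \<ge> 0"
    "rank_height k n j ^ k = - (time_scale k n * ln (1 - (real j / real n) ^ k))"
proof -
  have "ln (1 - (real j / real n) ^ k) \<le> 0" using rank_power_less_1[OF assms] by simp
  hence "- (time_scale k n * ln (1 - (real j / real n) ^ k)) \<ge> 0"
    using time_scale_nonneg[of k n] by (simp add: mult_nonneg_nonpos)
  thus "rank_height k n j \<ge> 0"
    "rank_height k n j ^ k = - (time_scale k n * ln (1 - (real j / real n) ^ k))"
    using assms(1) by (simp_all add: rank_height_def)
qed

lemma rank_height_mono:
  assumes "k \<ge> 1" "i \<le> j" "j < n"
  shows "rank_height k n i \<le> rank_height k n j"
proof -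
  have "(real i / real n) ^ k \<le> (real j / real n) ^ k"
    using assms by (intro power_mono divide_right_mono) auto
  hence "ln (1 - (real j / real n) ^ k) \<le> ln (1 - (real i / real n) ^ k)"
    using rank_power_less_1[OF assms(1,3)] by (subst ln_le_cancel_iff) auto
  thus ?thesis using assms(1) time_scale_nonneg[of k n]
    unfolding rank_height_def by (auto intro!: mult_left_mono)
qed

text \<open>
  By \<open>ln (1 - y) \<le> - y\<close>, rescaled ranks are at most their heights.
\<close>

lemma rank_height_ge:
  assumes k: "k \<ge> 1" and j: "j < n"
  shows "real j / time_scale k n \<le> rank_height k n j"
proof -
  have n: "n \<ge> 1" using j by simp
  let ?y = "(real j / real n) ^ k"
  have "ln (1 - ?y) \<le> - ?y" using ln_le_minus_one[of "1 - ?y"] rank_power_less_1[OF k j] by simp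
  hence "(real j / time_scale k n) ^ k \<le> rank_height k n j ^ k"
    unfolding rank_height_power(2)[OF k j] time_scale_power[OF n, symmetric]
    using time_scale_nonneg[of k n] mult_left_mono[of "ln (1 - ?y)" "- ?y" "time_scale k n"] by simp
  thus ?thesis using rank_height_power(1)[OF k j] k time_scale_nonneg[of k n]
    power_mono_iff[of "real j / time_scale k n" "rank_height k n j" k] by simp
qed

text \<open>
  By \<open>- ln (1 - y) \<le> y / (1 - y)\<close>, rescaled ranks are close to their heights when \<open>j / n\<close> is small.
\<close>

lemma rank_height_power_le:
  assumes k: "k \<ge> 1" and j: "j < n"
  shows "(1 - (real j / real n) ^ k) * rank_height k n j ^ k \<le> (real j / time_scale k n) ^ k"
proof -
  have n: "n \<ge> 1" using j by simp
  let ?y = "(real j / real n) ^ k"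
  have y: "0 < 1 - ?y" using rank_power_less_1[OF k j] by simp
  have "- ln (1 - ?y) = ln (1 / (1 - ?y))" using y by (simp add: ln_div)
  also have "\<dots> \<le> 1 / (1 - ?y) - 1" using y by (intro ln_le_minus_one) simp
  finally have "(1 - ?y) * (- ln (1 - ?y)) \<le> (1 - ?y) * (1 / (1 - ?y) - 1)"
    using y by (intro mult_left_mono) auto
  also have "\<dots> = ?y" using y by (subst right_diff_distrib) simp
  finally have "(1 - ?y) * (- ln (1 - ?y)) \<le> ?y" .
  hence "time_scale k n * ((1 - ?y) * (- ln (1 - ?y))) \<le> time_scale k n * ?y"
    by (rule mult_left_mono[OF _ time_scale_nonneg])
  thus ?thesis
    unfolding rank_height_power(2)[OF k j] time_scale_power[OF n, symmetric]
    by (simp add: algebra_simps)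
qed

lemma strip_rank_le: "strip_rank k n S i \<le> n"
  unfolding strip_rank_def by (rule Least_le) simp

lemma strip_rank_le_iff:
  assumes k: "k \<ge> 1" and j: "j < n"
  shows "strip_rank k n S i \<le> j \<longleftrightarrow> (\<exists>(s, x) \<in> time_strip S (time_scale k n) i. x \<le> rank_height k n j)"
proof
  let ?P = "\<lambda>j. n \<le> j \<or> (\<exists>(s, x) \<in> time_strip S (time_scale k n) i. x \<le> rank_height k n j)"
  assume le: "strip_rank k n S i \<le> j"
  have "?P (strip_rank k n S i)" unfolding strip_rank_def by (rule LeastI[of ?P n]) simp
  then obtain s x where "(s, x) \<in> time_strip S (time_scale k n) i" "x \<le> rank_height k n (strip_rank k n S i)"
    using le j by auto
  thus "\<exists>(s, x) \<in> time_strip S (time_scale k n) i. x \<le> rank_height k n j"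
    using rank_height_mono[OF k le j] by (intro bexI[of _ "(s, x)"]) auto
next
  assume "\<exists>(s, x) \<in> time_strip S (time_scale k n) i. x \<le> rank_height k n j"
  thus "strip_rank k n S i \<le> j" unfolding strip_rank_def by (intro Least_le) blast
qed

lemma strip_rank_upper:
  assumes k: "k \<ge> 1" and n: "n \<ge> 1" and S: "S \<subseteq> {0..} \<times> {0..}"
    and sx: "(s, x) \<in> time_strip S (time_scale k n) i"
  shows "real (strip_rank k n S i) \<le> x * time_scale k n + 1"
proof -
  let ?a = "time_scale k n"
  define j where "j = nat \<lceil>x * ?a\<rceil>"
  have x: "x \<ge> 0" using S sx by (auto simp: time_strip_def)
  hence xa: "x * ?a \<ge> 0" using time_scale_nonneg by simp
  have j: "x * ?a \<le> real j" "real j \<le> x * ?a + 1" using xa unfolding j_def by linarith+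
  have "strip_rank k n S i \<le> j"
  proof (cases "j < n")
    case True
    have "x \<le> real j / ?a" using j(1) time_scale_pos[OF n] by (simp add: pos_le_divide_eq)
    also have "\<dots> \<le> rank_height k n j" by (rule rank_height_ge[OF k True])
    finally show ?thesis using strip_rank_le_iff[OF k True] sx by blast
  next
    case False
    thus ?thesis using strip_rank_le[of k n S i] by simp
  qed
  thus ?thesis using j(2) by linarith
qed

lemma time_scale_at_top:
  assumes "k \<ge> 1"
  shows "filterlim (time_scale k) at_top sequentially"
proof -
  let ?p = "real k / (real k + 1)"
  have "?p > 0" using assms by (intro divide_pos_pos) auto
  hence "(\<lambda>n. real n powr (- ?p)) \<longlonglongrightarrow> 0"
    by (intro tendsto_neg_powr filterlim_real_sequentially) simp
  moreover have "\<forall>\<^sub>F n in sequentially. 0 < real n powr (- ?p)"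
    using eventually_gt_at_top[of 0] by eventually_elim simp
  ultimately have "filterlim (\<lambda>n. inverse (real n powr (- ?p))) at_top sequentially"
    by (rule filterlim_inverse_at_top)
  thus ?thesis by (simp add: time_scale_def[abs_def] powr_minus)
qed

lemma time_scale_over_n:
  "(\<lambda>n. time_scale k n / real n) \<longlonglongrightarrow> 0"
proof -
  have "- (1 / (real k + 1)) < 0" by simp
  hence "((\<lambda>x. x powr (- (1 / (real k + 1)))) \<longlongrightarrow> 0) at_top"
    by (intro tendsto_neg_powr filterlim_ident)
  from filterlim_compose[OF this filterlim_real_sequentially]
  have "(\<lambda>n. real n powr (- (1 / (real k + 1)))) \<longlonglongrightarrow> 0" .
  moreover have "\<forall>\<^sub>F n in sequentially. real n powr (- (1 / (real k + 1))) = time_scale k n / real n"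
    using eventually_ge_at_top[of 1]
  proof eventually_elim
    case (elim n)
    have p: "real k / (real k + 1) = 1 - 1 / (real k + 1)" by (simp add: field_simps)
    have "time_scale k n = real n powr 1 * real n powr (- (1 / (real k + 1)))"
      unfolding time_scale_def p using powr_add[of "real n" 1 "- (1 / (real k + 1))"] by simp
    thus ?case using elim by simp
  qed
  ultimately show ?thesis by (rule Lim_transform_eventually)
qed

text \<open>
  A rank below \<open>Y * a\<close> is small compared with \<open>n\<close>, since \<open>a / n\<close> tends to zero. So its height is
  almost its rescaled value by \<open>rank_height_power_le\<close>, uniformly in the strip and the configuration.
\<close>

lemma strip_rank_lower:
  assumes k: "k \<ge> 1" and e: "e > 0"
  shows "\<forall>\<^sub>F n in sequentially. \<forall>S i y. y \<le> Y \<longrightarrow>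
    (\<forall>(s, x)\<in>time_strip S (time_scale k n) i. y \<le> x) \<longrightarrow>
    (y - e) * time_scale k n \<le> real (strip_rank k n S i)"
proof -
  \<comment> \<open>Enlarging \<open>Y\<close> makes the bound positive, so that \<open>e / Z\<close> makes sense as a relative error.\<close>
  define Z where "Z = max Y e"
  have Z: "Z > 0" "Y \<le> Z" "e \<le> Z" using e by (auto simp: Z_def)
  have "(\<lambda>n. (Z * (time_scale k n / real n)) ^ k) \<longlonglongrightarrow> (Z * 0) ^ k"
    by (intro tendsto_intros time_scale_over_n)
  moreover have "(Z * 0) ^ k < e / Z" using k e Z by (simp add: power_0_left)
  ultimately have ev1: "\<forall>\<^sub>F n in sequentially. (Z * (time_scale k n / real n)) ^ k < e / Z"
    by (rule order_tendstoD(2))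
  have "(\<lambda>n. Z * (time_scale k n / real n)) \<longlonglongrightarrow> Z * 0"
    by (intro tendsto_intros time_scale_over_n)
  hence ev2: "\<forall>\<^sub>F n in sequentially. Z * (time_scale k n / real n) < 1"
    by (rule order_tendstoD(2)) simp
  show ?thesis using ev1 ev2 eventually_ge_at_top[of 1]
  proof (eventually_elim, intro allI impI)
    fix n S i y
    assume small: "(Z * (time_scale k n / real n)) ^ k < e / Z" and "Z * (time_scale k n / real n) < 1"
      and n: "1 \<le> n" and y: "y \<le> Y" and low: "\<forall>(s, x)\<in>time_strip S (time_scale k n) i. y \<le> x"
    define a where "a = time_scale k n"
    have a: "a > 0" using time_scale_pos[OF n] by (simp add: a_def)
    have Zn: "Z * a \<le> real n" using \<open>Z * _ < 1\<close> n by (simp add: a_def field_simps)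
    define j where "j = strip_rank k n S i"
    show "(y - e) * time_scale k n \<le> real (strip_rank k n S i)"
    proof (rule ccontr)
      assume "\<not> ?thesis"
      hence less: "real j < (y - e) * a" by (simp add: j_def a_def)
      hence ye: "y > e" using a zero_less_mult_pos2[of "y - e" a] by linarith
      have "(y - e) * a \<le> Z * a" using y Z e a by (intro mult_right_mono) auto
      hence jZ: "real j \<le> Z * a" using less by linarith
      have "(y - e) * a < y * a" "y * a \<le> Z * a" using y Z e a by auto
      hence jn: "j < n" using less Zn by linarith
      obtain s x where "(s, x) \<in> time_strip S a i" "x \<le> rank_height k n j"
        using strip_rank_le_iff[OF k jn, of S i] by (auto simp: j_def a_def)
      hence yh: "y \<le> rank_height k n j" using low by (auto simp: a_def)
      let ?r = "(real j / real n) ^ k"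
      have "?r \<le> (Z * (a / real n)) ^ k"
        using jZ n by (intro power_mono) (auto simp: divide_right_mono)
      hence r: "?r < e / Z" using small by (simp add: a_def)
      have r1: "0 < 1 - ?r" using rank_power_less_1[OF k jn] by simp
      \<comment> \<open>the relative slack \<open>1 - e / y\<close> beats the relative distortion \<open>1 - ?r\<close> of the heights\<close>
      have "(1 - ?r) * y ^ k \<le> (1 - ?r) * rank_height k n j ^ k"
        using yh ye e r1 by (intro mult_left_mono power_mono) auto
      also have "\<dots> \<le> (real j / a) ^ k" unfolding a_def by (rule rank_height_power_le[OF k jn])
      also have "\<dots> \<le> (y - e) ^ k"
        using less a by (intro power_mono) (auto simp: pos_divide_le_eq)
      also have "\<dots> = (1 - e / y) ^ k * y ^ k"
        using ye e by (simp flip: power_mult_distrib add: field_simps)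
      finally have "(1 - ?r) * y ^ k \<le> (1 - e / y) ^ k * y ^ k" .
      hence "1 - ?r \<le> (1 - e / y) ^ k" using ye e by simp
      also have "\<dots> \<le> (1 - e / y) ^ 1" using ye e k by (intro power_decreasing) auto
      finally have "e / y \<le> ?r" by simp
      moreover have "e / Z \<le> e / y" using y Z ye e by (intro divide_left_mono) auto
      ultimately show False using r by linarith
    qed
  qed
qed

lemma measure_rayleigh_intensity_rectangle:
  assumes k: "k \<ge> 1" and b: "0 \<le> b" "b \<le> c" and v: "0 \<le> v"
  shows "{b..<c} \<times> {0..v} \<in> sets (rayleigh_intensity k)"
    "emeasure (rayleigh_intensity k) ({b..<c} \<times> {0..v}) = ennreal ((c - b) * v ^ k)"
proof -
  let ?R = "{0..} \<times> {0..} :: (real \<times> real) set" and ?B = "{b..<c} \<times> {0..v}"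
  have R: "?R \<in> sets lborel" by (simp add: borel_closed closed_Times)
  have B': "?B \<in> sets lborel"
    unfolding lborel_prod[symmetric] by (intro pair_measureI) auto
  have sub: "?B \<subseteq> ?R" using b by auto
  have B: "?B \<in> sets (restrict_space lborel ?R)"
    using B' sub R by (simp add: sets_restrict_space_iff)
  thus "?B \<in> sets (rayleigh_intensity k)" by (simp add: rayleigh_intensity_def)
  let ?f = "\<lambda>(s, x). ennreal (real k * x ^ (k - 1))"
  have f [measurable]: "?f \<in> borel_measurable (lborel \<Otimes>\<^sub>M lborel)" by measurable
  hence f': "?f \<in> borel_measurable (lborel :: (real \<times> real) measure)" by (simp add: lborel_prod)
  have "emeasure (rayleigh_intensity k) ?B = (\<integral>\<^sup>+z. ?f z * indicator ?B z \<partial>restrict_space lborel ?R)"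
    unfolding rayleigh_intensity_def
    by (rule emeasure_density[OF measurable_restrict_space1[OF f'] B])
  also have "\<dots> = (\<integral>\<^sup>+z. ?f z * indicator ?B z * indicator ?R z \<partial>lborel)"
    by (rule nn_integral_restrict_space) (use R in simp)
  also have "\<dots> = (\<integral>\<^sup>+z. ?f z * indicator ?B z \<partial>(lborel \<Otimes>\<^sub>M lborel))"
    unfolding lborel_prod using sub by (intro nn_integral_cong) (auto split: split_indicator)
  also have "\<dots> = (\<integral>\<^sup>+s. \<integral>\<^sup>+x. ?f (s, x) * indicator ?B (s, x) \<partial>lborel \<partial>lborel)"
    using B' by (intro lborel.nn_integral_fst[symmetric] borel_measurable_times_ennreal f
        borel_measurable_indicator) (simp add: lborel_prod)
  also have "\<dots> = (\<integral>\<^sup>+s. indicator {b..<c} s * (\<integral>\<^sup>+x. ennreal (real k * x ^ (k - 1)) * indicator {0..v} x \<partial>lborel) \<partial>lborel)"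
    by (intro nn_integral_cong) (auto simp: indicator_times split: split_indicator)
  also have "(\<integral>\<^sup>+x. ennreal (real k * x ^ (k - 1)) * indicator {0..v} x \<partial>lborel) = ennreal (v ^ k - 0 ^ k)"
    using v k by (intro nn_integral_FTC_Icc) (auto intro!: derivative_eq_intros)
  also have "(\<integral>\<^sup>+s. indicator {b..<c} s * ennreal (v ^ k - 0 ^ k) \<partial>lborel) = ennreal (c - b) * ennreal (v ^ k)"
    using b k by (simp add: nn_integral_multc power_0_left)
  also have "\<dots> = ennreal ((c - b) * v ^ k)" using b v by (simp add: ennreal_mult)
  finally show "emeasure (rayleigh_intensity k) ?B = ennreal ((c - b) * v ^ k)" .
qed

text \<open>
  The rectangle whose Poisson mean is \<open>- ln (1 - (j / n) ^ k)\<close>; it is empty of points iff the rank of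
  the strip exceeds \<open>j\<close>.
\<close>

definition rank_cell :: "nat \<Rightarrow> nat \<Rightarrow> nat \<Rightarrow> nat \<Rightarrow> (real \<times> real) set" where
  "rank_cell k n i j =
     {real i / time_scale k n..<(real i + 1) / time_scale k n} \<times> {0..rank_height k n j}"

lemma strip_rank_le_iff_cell:
  assumes k: "k \<ge> 1" and j: "j < n" and S: "S \<subseteq> {0..} \<times> {0..}"
  shows "strip_rank k n S i \<le> j \<longleftrightarrow> S \<inter> rank_cell k n i j \<noteq> {}"
proof -
  have "time_scale k n > 0" using j time_scale_pos by simp
  thus ?thesis unfolding strip_rank_le_iff[OF k j] using S
    by (fastforce simp: time_strip_def rank_cell_def pos_divide_le_eq pos_less_divide_eq)
qed

lemma point_count_eq_0_iff: "point_count P B \<omega> = 0 \<longleftrightarrow> P \<omega> \<inter> B = {}"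
  unfolding point_count_def by (simp add: emeasure_count_space_eq_0)

context
  fixes k n :: nat and N :: "'b measure" and P :: "'b \<Rightarrow> (real \<times> real) set"
  assumes k: "k \<ge> 1" and ppp: "poisson_point_process N (rayleigh_intensity k) P"
begin

lemma points_subset: "\<omega> \<in> space N \<Longrightarrow> P \<omega> \<subseteq> {0..} \<times> {0..}"
  using ppp unfolding poisson_point_process_def
  by (simp add: rayleigh_intensity_def space_restrict_space)

lemma points_finite: "\<omega> \<in> space N \<Longrightarrow> bounded B \<Longrightarrow> finite (P \<omega> \<inter> B)"
  using ppp unfolding poisson_point_process_def by blast

lemma rank_cell_measure:
  assumes j: "j < n"
  shows "rank_cell k n i j \<in> sets (rayleigh_intensity k)"
    "emeasure (rayleigh_intensity k) (rank_cell k n i j) = ennreal (- ln (1 - (real j / real n) ^ k))"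
proof -
  have a: "time_scale k n > 0" using j time_scale_pos by simp
  have b: "0 \<le> real i / time_scale k n" "real i / time_scale k n \<le> (real i + 1) / time_scale k n"
    using a by (auto simp: divide_right_mono)
  note r = measure_rayleigh_intensity_rectangle[OF k b rank_height_power(1)[OF k j]]
  show "rank_cell k n i j \<in> sets (rayleigh_intensity k)" unfolding rank_cell_def by (rule r)
  have "((real i + 1) / time_scale k n - real i / time_scale k n) * rank_height k n j ^ k =
      - ln (1 - (real j / real n) ^ k)"
    unfolding rank_height_power(2)[OF k j] using a by (simp add: field_simps)
  thus "emeasure (rayleigh_intensity k) (rank_cell k n i j) = ennreal (- ln (1 - (real j / real n) ^ k))"
    unfolding rank_cell_def r by simp
qed

lemma strip_rank_greater_event:
  assumes j: "j < n"
  shows "{\<omega> \<in> space N. j < strip_rank k n (P \<omega>) i} =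
      point_count P (rank_cell k n i j) -` {0} \<inter> space N"
  using strip_rank_le_iff_cell[OF k j points_subset] point_count_eq_0_iff[of P "rank_cell k n i j"]
  by (auto simp: not_le[symmetric])

lemma strip_rank_measurable: "(\<lambda>\<omega>. strip_rank k n (P \<omega>) i) \<in> N \<rightarrow>\<^sub>M count_space UNIV"
proof -
  have le: "{\<omega> \<in> space N. strip_rank k n (P \<omega>) i \<le> j} \<in> sets N" for j
  proof (cases "j < n")
    case True
    have "point_count P (rank_cell k n i j) \<in> borel_measurable N"
      using ppp rank_cell_measure(1)[OF True] by (simp add: poisson_point_process_def)
    hence "{\<omega> \<in> space N. j < strip_rank k n (P \<omega>) i} \<in> sets N"
      unfolding strip_rank_greater_event[OF True] by (intro measurable_sets) auto
    moreover have "{\<omega> \<in> space N. strip_rank k n (P \<omega>) i \<le> j} =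
        space N - {\<omega> \<in> space N. j < strip_rank k n (P \<omega>) i}" by auto
    ultimately show ?thesis by (simp only: sets.Diff sets.top)
  next
    case False
    hence "strip_rank k n (P \<omega>) i \<le> j" for \<omega> using strip_rank_le[of k n "P \<omega>" i] by simp
    thus ?thesis by simp
  qed
  show ?thesis
  proof (subst measurable_count_space_eq_countable, simp, intro conjI ballI)
    fix j :: nat
    have "(\<lambda>\<omega>. strip_rank k n (P \<omega>) i) -` {j} \<inter> space N =
        {\<omega> \<in> space N. strip_rank k n (P \<omega>) i \<le> j} -
        (\<Union>l\<in>{..<j}. {\<omega> \<in> space N. strip_rank k n (P \<omega>) i \<le> l})"
      by (auto simp: not_le) (metis lessThan_iff le_neq_implies_less less_irrefl)
    thus "(\<lambda>\<omega>. strip_rank k n (P \<omega>) i) -` {j} \<inter> space N \<in> sets N"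
      using le by (simp only:, intro sets.Diff sets.finite_UN) auto
  qed auto
qed

text \<open>
  The probability that a cell is empty is \<open>exp (ln (1 - (j / n) ^ k)) = 1 - (j / n) ^ k\<close>.
\<close>

lemma strip_rank_law:
  assumes n: "n \<ge> 1"
  shows "measure N {\<omega> \<in> space N. strip_rank k n (P \<omega>) i = b} = pmf (top_rank_pmf k n) b"
proof (rule nat_law_from_cdf[OF _ strip_rank_measurable])
  show N: "prob_space N" using ppp by (simp add: poisson_point_process_def)
  interpret prob_space N by fact
  fix j
  show "measure N {\<omega> \<in> space N. strip_rank k n (P \<omega>) i \<le> j} = measure (measure_pmf (top_rank_pmf k n)) {..j}"
  proof (cases "j < n")
    case True
    let ?B = "rank_cell k n i j" and ?y = "(real j / real n) ^ k"
    have y: "0 < 1 - ?y" "ln (1 - ?y) \<le> 0" using rank_power_less_1[OF k True] by auto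
    have "measure N {\<omega> \<in> space N. j < strip_rank k n (P \<omega>) i} =
        measure N {\<omega> \<in> space N. point_count P ?B \<omega> = of_nat 0}"
      unfolding strip_rank_greater_event[OF True] by (intro arg_cong[where f = "measure N"]) auto
    also have "\<dots> = exp (- measure (rayleigh_intensity k) ?B) * measure (rayleigh_intensity k) ?B ^ 0 / fact 0"
    proof -
      have "measure N {\<omega> \<in> space N. point_count P B \<omega> = of_nat l} =
          exp (- measure (rayleigh_intensity k) B) * measure (rayleigh_intensity k) B ^ l / fact l"
        if "B \<in> sets (rayleigh_intensity k)" "emeasure (rayleigh_intensity k) B < \<infinity>" for B l
        using ppp that unfolding poisson_point_process_def by blast
      thus ?thesis by this (use rank_cell_measure[OF True, of i] in auto)
    qed
    also have "measure (rayleigh_intensity k) ?B = - ln (1 - ?y)"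
      using rank_cell_measure(2)[OF True, of i] y by (simp add: measure_def)
    finally have gr: "measure N {\<omega> \<in> space N. j < strip_rank k n (P \<omega>) i} = 1 - ?y" using y by simp
    have "{\<omega> \<in> space N. j < strip_rank k n (P \<omega>) i} \<in> sets N"
      using measurable_sets[OF strip_rank_measurable, of "{j<..}" i]
      by (simp add: vimage_def Int_def conj_commute)
    moreover have "{\<omega> \<in> space N. strip_rank k n (P \<omega>) i \<le> j} =
        space N - {\<omega> \<in> space N. j < strip_rank k n (P \<omega>) i}" by auto
    ultimately have "measure N {\<omega> \<in> space N. strip_rank k n (P \<omega>) i \<le> j} = ?y"
      using gr by (simp add: prob_compl)
    thus ?thesis using top_rank_cdf[OF k _ n, of j] True by simp
  next
    case False
    hence "strip_rank k n (P \<omega>) i \<le> j" for \<omega> using strip_rank_le[of k n "P \<omega>" i] by simp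
    moreover have "measure (measure_pmf (top_rank_pmf k n)) {..j} = 1"
    proof -
      have "1 = measure (measure_pmf (top_rank_pmf k n)) {..n}" using top_rank_cdf[OF k order_refl n] n by simp
      also have "\<dots> \<le> measure (measure_pmf (top_rank_pmf k n)) {..j}"
        using False by (intro measure_pmf.finite_measure_mono) auto
      finally show ?thesis by (simp add: antisym)
    qed
    ultimately show ?thesis by (simp add: prob_space)
  qed
qed

text \<open>
  The events that the rank of the strip \<open>i\<close> is at least \<open>b i\<close> generate, and they say that the cells with
  rank \<open>b i - 1\<close>, which are disjoint, are empty. The bound \<open>b i = 0\<close> is matched by the empty cell, and
  bounds above \<open>n\<close> give null events on both sides.
\<close>

lemma strip_rank_indep:
  assumes n: "n \<ge> 1"
  shows "prob_space.indep_vars N (\<lambda>_. count_space UNIV) (\<lambda>i \<omega>. strip_rank k n (P \<omega>) i) {..<Suc m}"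
proof -
  have "prob_space N" using ppp by (simp add: poisson_point_process_def)
  then interpret prob_space N .
  have a: "time_scale k n > 0" using n time_scale_pos by simp
  let ?U = "\<lambda>i \<omega>. strip_rank k n (P \<omega>) i"
  have gen: "sets (count_space UNIV) = sigma_sets (space (count_space UNIV)) (range (atLeast :: nat \<Rightarrow> _))"
  proof -
    have "A \<in> sigma_sets UNIV (range atLeast)" for A :: "nat set"
    proof -
      have s: "{b} \<in> sigma_sets UNIV (range atLeast)" for b :: nat
      proof -
        have "{b} = {b..} - {Suc b..}" by auto
        moreover have "{b..} - {Suc b..} \<in> sigma_sets UNIV (range atLeast)"
          by (rule sigma_algebra.axioms(1)[OF sigma_algebra_sigma_sets, THEN algebra.axioms(1), THEN ring_of_sets.Diff]) auto
        ultimately show ?thesis by simp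
      qed
      have "(\<Union>b\<in>A. {b}) \<in> sigma_sets UNIV (range atLeast)"
        by (rule sigma_sets_UNION) (auto intro: s)
      thus ?thesis by simp
    qed
    thus ?thesis by auto
  qed
  have "Int_stable (range (atLeast :: nat \<Rightarrow> _))"
  proof (rule Int_stableI)
    fix A B :: "nat set" assume "A \<in> range atLeast" "B \<in> range atLeast"
    then obtain a b where "A = {a..}" "B = {b..}" by blast
    hence "A \<inter> B = {max a b..}" by auto
    thus "A \<inter> B \<in> range atLeast" by blast
  qed
  moreover have "prob (\<Inter>i\<in>{..<Suc m}. ?U i -` A i \<inter> space N) = (\<Prod>i\<in>{..<Suc m}. prob (?U i -` A i \<inter> space N))"
    if A: "A \<in> (\<Pi> i\<in>{..<Suc m}. range atLeast)" for A
  proof -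
    have "\<forall>i\<in>{..<Suc m}. \<exists>b. A i = {b..}" using A by auto
    then obtain b where b: "\<And>i. i < Suc m \<Longrightarrow> A i = {b i..}" by (metis lessThan_iff)
    show ?thesis
    proof (cases "\<forall>i<Suc m. b i \<le> n")
      case False
      then obtain i where i: "i < Suc m" "n < b i" by (auto simp: not_le)
      have "?U i \<omega> \<notin> A i" for \<omega> using strip_rank_le[of k n "P \<omega>" i] i b by simp
      hence e: "?U i -` A i = {}" by auto
      have "(\<Inter>i\<in>{..<Suc m}. ?U i -` A i \<inter> space N) = {}" using e i by auto
      moreover have "(\<Prod>i\<in>{..<Suc m}. prob (?U i -` A i \<inter> space N)) = 0"
        using e i by (intro prod_zero) (auto intro!: bexI[of _ i])
      ultimately show ?thesis by simp
    next
      case True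
      define B where "B i = (if b i = 0 then {} else rank_cell k n i (b i - 1))" for i
      have ev: "?U i -` A i \<inter> space N = point_count P (B i) -` {0} \<inter> space N" if i: "i < Suc m" for i
      proof (cases "b i = 0")
        case True
        thus ?thesis using b[OF i] by (auto simp: B_def point_count_eq_0_iff)
      next
        case False
        hence j: "b i - 1 < n" using True i by auto
        have "?U i -` A i \<inter> space N = {\<omega> \<in> space N. b i - 1 < ?U i \<omega>}" using b[OF i] False by auto
        thus ?thesis using strip_rank_greater_event[OF j] False by (simp add: B_def)
      qed
      have "B i \<in> sets (rayleigh_intensity k)" if "i < Suc m" for i
        using True that rank_cell_measure(1)[of "b i - 1" i] by (auto simp: B_def)
      moreover have "disjoint_family_on B {..<Suc m}"
        unfolding disjoint_family_on_def
      proof (intro ballI impI)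
        fix i j :: nat assume "i \<noteq> j"
        have "rank_cell k n i l \<inter> rank_cell k n j l' = {}" for l l'
          using a \<open>i \<noteq> j\<close> by (auto simp: rank_cell_def pos_divide_le_eq pos_less_divide_eq)
        thus "B i \<inter> B j = {}" by (auto simp: B_def)
      qed
      ultimately have "indep_vars (\<lambda>_. borel) (\<lambda>i. point_count P (B i)) {..<Suc m}"
        using ppp unfolding poisson_point_process_def by simp
      from indep_varsD_finite[OF this, of "\<lambda>_. {0}"]
      have "prob (\<Inter>i\<in>{..<Suc m}. point_count P (B i) -` {0} \<inter> space N) =
          (\<Prod>i\<in>{..<Suc m}. prob (point_count P (B i) -` {0} \<inter> space N))" by auto
      thus ?thesis using ev by simp
    qed
  qed
  ultimately show ?thesis
    using gen strip_rank_measurable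
    by (subst indep_vars_finite[where E = "\<lambda>_. range atLeast"]) (auto intro!: image_eqI[of _ _ 0])
qed

end

section \<open>The scaling limit\<close>

theorem theorem1p3:
  fixes k :: nat
    and M :: "nat \<Rightarrow> 'a measure" and X :: "nat \<Rightarrow> nat \<Rightarrow> 'a \<Rightarrow> nat"
    and N :: "'b measure" and P :: "'b \<Rightarrow> (real \<times> real) set"
  assumes "k \<ge> 1"
    and "\<And>n. n \<ge> 1 \<Longrightarrow> maximal_choice_walk k n (M n) (X n)"
    and "poisson_point_process N (rayleigh_intensity k) P"
  shows "converges_in_distribution skorokhod_J1
    M (\<lambda>n \<omega>. \<lambda>t\<in>{0..}. real n powr (- (real k / (real k + 1))) *
          real (le_length (X n) (nat \<lfloor>t * real n powr (real k / (real k + 1))\<rfloor>) \<omega>))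
    N (\<lambda>\<omega>. \<lambda>t\<in>{0..}. rayleigh (P \<omega>) t)"
proof -
  note k = assms(1) and walk = assms(2) and ppp = assms(3)
  have N: "prob_space N" using ppp by (simp add: poisson_point_process_def)
  define Z where "Z n \<omega> = scaled_path (time_scale k n) (\<lambda>m. le_length (X n) m \<omega>)" for n \<omega>
  define W where "W n \<omega> = scaled_path (time_scale k n) (min_chain (strip_rank k n (P \<omega>)))" for n \<omega>
  define R where "R \<omega> = (\<lambda>t\<in>{0..}. rayleigh (P \<omega>) t)" for \<omega>
  have chain: "(\<lambda>\<omega>. min_chain (strip_rank k n (P \<omega>)) m) \<in> N \<rightarrow>\<^sub>M count_space UNIV" for n m
    using measurable_min_chain[OF strip_rank_measurable[OF k ppp]] by simp
  have W: "W n \<in> N \<rightarrow>\<^sub>M borel_of skorokhod_J1" for n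
    unfolding W_def[abs_def]
    using measurable_scaled_path[OF time_scale_nonneg chain] by simp
  have lim: "limitin skorokhod_J1 (\<lambda>n. W n \<omega>) (R \<omega>) sequentially" if \<omega>: "\<omega> \<in> space N" for \<omega>
    unfolding W_def R_def
  proof (rule scaled_min_chain_tendsto_rayleigh[OF points_subset[OF k ppp \<omega>]
        points_finite[OF k ppp \<omega>] time_scale_at_top[OF k] time_scale_nonneg
        strip_rank_upper[OF k _ points_subset[OF k ppp \<omega>]]])
    fix Y e :: real assume "e > 0"
    show "\<forall>\<^sub>F n in sequentially. \<forall>i y. y \<le> Y \<longrightarrow>
        (\<forall>(s, x)\<in>time_strip (P \<omega>) (time_scale k n) i. y \<le> x) \<longrightarrow>
        (y - e) * time_scale k n \<le> real (strip_rank k n (P \<omega>) i)"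
      using strip_rank_lower[OF k \<open>e > 0\<close>, of Y] by (rule eventually_mono) blast
  qed auto
  have Z: "Z n \<in> M n \<rightarrow>\<^sub>M borel_of skorokhod_J1" if n: "n \<ge> 1" for n
    unfolding Z_def[abs_def]
    by (rule measurable_scaled_path[OF time_scale_nonneg le_length_measurable[OF walk[OF n]]])
  have "(\<lambda>n. \<integral>\<omega>. \<phi> (Z n \<omega>) \<partial>M n) \<longlonglongrightarrow> (\<integral>\<omega>. \<phi> (R \<omega>) \<partial>N)"
    if \<phi>: "continuous_map skorokhod_J1 euclideanreal \<phi>" "bounded (\<phi> ` topspace skorokhod_J1)" for \<phi>
  proof (rule Lim_transform_eventually[OF integral_J1_limit[OF N W lim \<phi>]])
    show "\<forall>\<^sub>F n in sequentially. (\<integral>\<omega>. \<phi> (W n \<omega>) \<partial>N) = (\<integral>\<omega>. \<phi> (Z n \<omega>) \<partial>M n)"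
      using eventually_ge_at_top[of 1]
    proof eventually_elim
      case (elim n)
      have M: "prob_space (M n)" using walk[OF elim] by (simp add: maximal_choice_walk_def)
      show ?case unfolding W_def Z_def
        by (rule scaled_path_integral_eq[OF time_scale_nonneg N M chain
              le_length_measurable[OF walk[OF elim]]
              le_length_law_eq_min_chain[OF k elim walk[OF elim] N strip_rank_indep[OF k ppp elim]
                strip_rank_law[OF k ppp elim], symmetric] \<phi>])
    qed
  qed
  moreover have "R \<in> N \<rightarrow>\<^sub>M borel_of skorokhod_J1" by (rule measurable_J1_limit[OF W lim])
  moreover have "\<forall>\<^sub>F n in sequentially. Z n \<in> M n \<rightarrow>\<^sub>M borel_of skorokhod_J1"
    using eventually_ge_at_top[of 1] by eventually_elim (rule Z)
  ultimately have "converges_in_distribution skorokhod_J1 M Z N R"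
    by (simp add: converges_in_distribution_def)
  thus ?thesis
    by (simp add: Z_def[abs_def] R_def[abs_def] scaled_path_def time_scale_def powr_minus)
qed

end
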